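(* Let $E$ be a pseudo effect algebra whose state space $\mathcal S(E)$ is a nonempty Bauer simplex, let $m$ be a Jordan signed measure on $E$ and let $m=\alpha_1s_1-\alpha_2s_2$ be its canonical Jordan decomposition. Then there are unique regular Borel probability measures $\mu_{s_1},\mu_{s_2}$ on $\mathcal B(\mathcal S(E))$ with $\mu_{s_i}(\partial_e\mathcal S(E))=1$ ($i=1,2$) such that, with $\mu_m:=\alpha_1\mu_{s_1}-\alpha_2\mu_{s_2}$, $$m(a)=\alpha_1\int_{\partial_e\mathcal S(E)}\hat a(x)\,d\mu_{s_1}(x)-\alpha_2\int_{\partial_e\mathcal S(E)}\hat a(x)\,d\mu_{s_2}(x)=\int_{\partial_e\mathcal S(E)}\hat a(x)\,d\mu_m(x)$$ for every $a\in E$, where $\hat a(x)=x(a)$.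
   Context: Pseudo effect algebra: partial algebra $(E;+,0,1)$ such that for all $a,b,c$: (i) $a+b$ and $(a+b)+c$ exist iff $b+c$ and $a+(b+c)$ exist, and then they are equal; (ii) there is exactly one $d$ and one $e$ with $a+d=e+a=1$; (iii) if $a+b$ exists there are $d,e$ with $a+b=d+a=b+e$; (iv) if $1+a$ or $a+1$ exists then $a=0$. Signed measure: $m:E\to\mathbb R$ additive on defined sums; measure: nonnegative one; state: measure with $s(1)=1$; $\mathcal S(E)$: set of states with the pointwise-convergence topology; $\partial_e\mathcal S(E)$: its extreme points. Bauer simplex: a compact simplex (convex set affinely isomorphic to a base of a lattice cone) in a locally convex Hausdorff space whose set of extreme points is compact. Jordan signed measure: difference of two measures; the set $\mathcal J(E)$ of these, ordered by $m_1\le^+m_2$ iff $m_2-m_1$ is a measure, is a lattice-ordered group (the paper uses this for $E$ with the Riesz Decomposition Property); $m^+=m\vee0$, $m^-=-(m\wedge0)$. Canonical Jordan decomposition: $m=\alpha_1s_1-\alpha_2s_2$ with $\alpha_i\ge0$, $s_i$ states, $\alpha_1s_1=m^+$, $\alpha_2s_2=m^-$. *)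

theory Defs
  imports "HOL-Probability.Probability"
begin

text \<open>The pseudo effect algebra E is modelled by a type 'a (its carrier is UNIV),
  a partial addition pl (None = undefined), and constants z (=0) and u (=1).\<close>

definition pseudo_effect_algebra ::
  "('a \<Rightarrow> 'a \<Rightarrow> 'a option) \<Rightarrow> 'a \<Rightarrow> 'a \<Rightarrow> bool" where
  "pseudo_effect_algebra pl z u \<longleftrightarrow>
     (\<forall>a b c. Option.bind (pl a b) (\<lambda>x. pl x c) = Option.bind (pl b c) (\<lambda>y. pl a y)) \<and>
     (\<forall>a. (\<exists>!d. pl a d = Some u) \<and> (\<exists>!e. pl e a = Some u)) \<and>
     (\<forall>a b x. pl a b = Some x \<longrightarrow> (\<exists>d e. pl d a = Some x \<and> pl b e = Some x)) \<and>
     (\<forall>a. (pl u a \<noteq> None \<or> pl a u \<noteq> None) \<longrightarrow> a = z)"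

definition signed_measure :: "('a \<Rightarrow> 'a \<Rightarrow> 'a option) \<Rightarrow> ('a \<Rightarrow> real) \<Rightarrow> bool" where
  "signed_measure pl m \<longleftrightarrow> (\<forall>a b c. pl a b = Some c \<longrightarrow> m c = m a + m b)"

definition pea_measure :: "('a \<Rightarrow> 'a \<Rightarrow> 'a option) \<Rightarrow> ('a \<Rightarrow> real) \<Rightarrow> bool" where
  "pea_measure pl m \<longleftrightarrow> signed_measure pl m \<and> (\<forall>a. 0 \<le> m a)"

definition pea_state :: "('a \<Rightarrow> 'a \<Rightarrow> 'a option) \<Rightarrow> 'a \<Rightarrow> ('a \<Rightarrow> real) \<Rightarrow> bool" where
  "pea_state pl u s \<longleftrightarrow> pea_measure pl s \<and> s u = 1"

text \<open>The state space S(E); it carries the topology of pointwise convergence,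
  i.e. the (subspace of the) product topology on 'a \<Rightarrow> real.\<close>
definition state_space :: "('a \<Rightarrow> 'a \<Rightarrow> 'a option) \<Rightarrow> 'a \<Rightarrow> ('a \<Rightarrow> real) set" where
  "state_space pl u = {s. pea_state pl u s}"

definition jordan_signed_measure :: "('a \<Rightarrow> 'a \<Rightarrow> 'a option) \<Rightarrow> ('a \<Rightarrow> real) \<Rightarrow> bool" where
  "jordan_signed_measure pl m \<longleftrightarrow>
     (\<exists>m1 m2. pea_measure pl m1 \<and> pea_measure pl m2 \<and> m = (\<lambda>a. m1 a - m2 a))"

definition jle :: "('a \<Rightarrow> 'a \<Rightarrow> 'a option) \<Rightarrow> ('a \<Rightarrow> real) \<Rightarrow> ('a \<Rightarrow> real) \<Rightarrow> bool" where
  "jle pl m1 m2 \<longleftrightarrow> pea_measure pl (\<lambda>a. m2 a - m1 a)"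

definition jsup_is ::
  "('a \<Rightarrow> 'a \<Rightarrow> 'a option) \<Rightarrow> ('a \<Rightarrow> real) \<Rightarrow> ('a \<Rightarrow> real) \<Rightarrow> ('a \<Rightarrow> real) \<Rightarrow> bool" where
  "jsup_is pl m1 m2 j \<longleftrightarrow> jordan_signed_measure pl j \<and> jle pl m1 j \<and> jle pl m2 j \<and>
     (\<forall>k. jordan_signed_measure pl k \<and> jle pl m1 k \<and> jle pl m2 k \<longrightarrow> jle pl j k)"

definition jinf_is ::
  "('a \<Rightarrow> 'a \<Rightarrow> 'a option) \<Rightarrow> ('a \<Rightarrow> real) \<Rightarrow> ('a \<Rightarrow> real) \<Rightarrow> ('a \<Rightarrow> real) \<Rightarrow> bool" where
  "jinf_is pl m1 m2 j \<longleftrightarrow> jordan_signed_measure pl j \<and> jle pl j m1 \<and> jle pl j m2 \<and>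
     (\<forall>k. jordan_signed_measure pl k \<and> jle pl k m1 \<and> jle pl k m2 \<longrightarrow> jle pl k j)"

definition canonical_jordan_decomposition ::
  "('a \<Rightarrow> 'a \<Rightarrow> 'a option) \<Rightarrow> 'a \<Rightarrow> ('a \<Rightarrow> real) \<Rightarrow> real \<Rightarrow> ('a \<Rightarrow> real) \<Rightarrow> real \<Rightarrow> ('a \<Rightarrow> real) \<Rightarrow> bool" where
  "canonical_jordan_decomposition pl u m \<alpha>1 s1 \<alpha>2 s2 \<longleftrightarrow>
     0 \<le> \<alpha>1 \<and> 0 \<le> \<alpha>2 \<and> pea_state pl u s1 \<and> pea_state pl u s2 \<and>
     m = (\<lambda>a. \<alpha>1 * s1 a - \<alpha>2 * s2 a) \<and>
     jsup_is pl m (\<lambda>_. 0) (\<lambda>a. \<alpha>1 * s1 a) \<and>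
     jinf_is pl m (\<lambda>_. 0) (\<lambda>a. - (\<alpha>2 * s2 a))"

definition fconvex :: "('a \<Rightarrow> real) set \<Rightarrow> bool" where
  "fconvex K \<longleftrightarrow> (\<forall>x\<in>K. \<forall>y\<in>K. \<forall>t::real. 0 \<le> t \<and> t \<le> 1 \<longrightarrow> (\<lambda>a. (1 - t) * x a + t * y a) \<in> K)"

definition fextreme_points :: "('a \<Rightarrow> real) set \<Rightarrow> ('a \<Rightarrow> real) set" where
  "fextreme_points K = {x \<in> K. \<forall>y\<in>K. \<forall>z\<in>K. \<forall>t::real. 0 < t \<and> t < 1 \<and>
      x = (\<lambda>a. t * y a + (1 - t) * z a) \<longrightarrow> y = x \<and> z = x}"

text \<open>The cone generated by K (K lies in the hyperplane s(1) = 1, so K is a base of it).\<close>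
definition fcone :: "('a \<Rightarrow> real) set \<Rightarrow> ('a \<Rightarrow> real) set" where
  "fcone K = {f. \<exists>t\<ge>0. \<exists>s\<in>K. f = (\<lambda>a. t * s a)}"

definition cone_le :: "('a \<Rightarrow> real) set \<Rightarrow> ('a \<Rightarrow> real) \<Rightarrow> ('a \<Rightarrow> real) \<Rightarrow> bool" where
  "cone_le C f g \<longleftrightarrow> (\<lambda>a. g a - f a) \<in> C"

definition lattice_cone :: "('a \<Rightarrow> real) set \<Rightarrow> bool" where
  "lattice_cone C \<longleftrightarrow> (\<forall>x\<in>C. \<forall>y\<in>C.
     (\<exists>z\<in>C. cone_le C x z \<and> cone_le C y z \<and> (\<forall>w\<in>C. cone_le C x w \<and> cone_le C y w \<longrightarrow> cone_le C z w)) \<and>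
     (\<exists>z\<in>C. cone_le C z x \<and> cone_le C z y \<and> (\<forall>w\<in>C. cone_le C w x \<and> cone_le C w y \<longrightarrow> cone_le C w z)))"

definition fsimplex :: "('a \<Rightarrow> real) set \<Rightarrow> bool" where
  "fsimplex K \<longleftrightarrow> fconvex K \<and> lattice_cone (fcone K)"

definition bauer_simplex :: "('a \<Rightarrow> real) set \<Rightarrow> bool" where
  "bauer_simplex K \<longleftrightarrow> compact K \<and> fsimplex K \<and> compact (fextreme_points K)"

definition regular_borel_prob :: "('a \<Rightarrow> real) set \<Rightarrow> ('a \<Rightarrow> real) measure \<Rightarrow> bool" where
  "regular_borel_prob K \<mu> \<longleftrightarrow>
     sets \<mu> = sets (restrict_space borel K) \<and> space \<mu> = K \<and> prob_space \<mu> \<and>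
     (\<forall>A\<in>sets \<mu>.
        measure \<mu> A = (SUP C\<in>{C. compact C \<and> C \<subseteq> A}. measure \<mu> C) \<and>
        measure \<mu> A = (INF U\<in>{U. openin (top_of_set K) U \<and> A \<subseteq> U}. measure \<mu> U))"

definition representing_measure ::
  "('a \<Rightarrow> 'a \<Rightarrow> 'a option) \<Rightarrow> 'a \<Rightarrow> ('a \<Rightarrow> real) \<Rightarrow> ('a \<Rightarrow> real) measure \<Rightarrow> bool" where
  "representing_measure pl u s \<mu> \<longleftrightarrow>
     regular_borel_prob (state_space pl u) \<mu> \<and>
     measure \<mu> (fextreme_points (state_space pl u)) = 1 \<and>
     (\<forall>a. s a = (LINT x:fextreme_points (state_space pl u)|\<mu>. x a))"

end

theory Submission
  imports Defs
begin

text \<open>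
  Write \<open>K\<close> for the state space and \<open>X\<close> for its compact set of extreme points. Every state \<open>s\<close> has
  exactly one representing measure; the Jordan decomposition then only enters as \<open>m = \<alpha>1 s1 - \<alpha>2 s2\<close>.

  Existence. The barycentres of finitely additive probabilities on a compact \<open>C \<subseteq> K\<close> form a compact
  convex set, and a finitely additive probability on \<open>C\<close> yields, by Caratheodory's construction, a
  regular Borel probability with the same barycentre. For \<open>C = X\<close> this set is all of \<open>K\<close>: otherwise a
  linear functional of finitely many coordinates would separate a state from it, although on \<open>K\<close> that
  functional attains its maximum in \<open>X\<close>.

  Uniqueness. Let \<open>\<mu>\<close> and \<open>\<nu>\<close> represent \<open>s\<close> and put \<open>s_C = \<integral>_C x d\<mu>\<close>, \<open>t_D = \<integral>_D x d\<nu>\<close>. If \<open>C\<close> and \<open>D\<close>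
  are disjoint compact subsets of \<open>X\<close>, then \<open>s_C \<sqinter> t_D = 0\<close>: a nonzero lower bound would have a
  representing measure, and that measure vanishes near every point of \<open>X - C\<close> and of \<open>X - D\<close>. Since
  \<open>t_D \<le> s = s_C + s_(K - C)\<close>, Riesz decomposition gives \<open>t_D \<le> s_(K - C)\<close>, so \<open>\<nu> D \<le> \<mu> (K - C)\<close>;
  regularity turns this into \<open>\<nu> D \<le> \<mu> D\<close>.
\<close>

section \<open>Functions with the product topology\<close>

lemma open_coordinate_vimage:
  fixes U :: "'b::topological_space set"
  assumes "open U" shows "open ((\<lambda>h :: 'a \<Rightarrow> 'b. h i) -` U)"
  using assms by (intro open_vimage) auto

text \<open>Distinct functions are separated at a coordinate where they differ. The instances climb
  the class hierarchy up to Hausdorff spaces, so that compact sets of functions become closed and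
  hence Borel.\<close>

instance "fun" :: (type, t0_space) t0_space
proof
  fix f g :: "'a \<Rightarrow> 'b"
  assume "f \<noteq> g"
  then obtain i where "f i \<noteq> g i" by auto
  then obtain U where U: "open U" and "\<not> (f i \<in> U \<longleftrightarrow> g i \<in> U)"
    by (metis separation_t0)
  then have "\<not> (f \<in> (\<lambda>h. h i) -` U \<longleftrightarrow> g \<in> (\<lambda>h. h i) -` U)" by simp
  with open_coordinate_vimage[OF U] show "\<exists>U. open U \<and> \<not> (f \<in> U \<longleftrightarrow> g \<in> U)"
    by metis
qed

instance "fun" :: (type, t1_space) t1_space
proof
  fix f g :: "'a \<Rightarrow> 'b"
  assume "f \<noteq> g"
  then obtain i where "f i \<noteq> g i" by auto
  then obtain U where U: "open U" and "f i \<in> U" "g i \<notin> U"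
    by (metis separation_t1)
  then have "f \<in> (\<lambda>h. h i) -` U" "g \<notin> (\<lambda>h. h i) -` U" by simp_all
  with open_coordinate_vimage[OF U] show "\<exists>U. open U \<and> f \<in> U \<and> g \<notin> U"
    by metis
qed

instance "fun" :: (type, t2_space) t2_space
proof
  fix f g :: "'a \<Rightarrow> 'b"
  assume "f \<noteq> g"
  then obtain i where "f i \<noteq> g i" by auto
  then obtain U V where U: "open U" and V: "open V" and UV: "f i \<in> U" "g i \<in> V" "U \<inter> V = {}"
    by (metis separation_t2)
  then have "f \<in> (\<lambda>h. h i) -` U" "g \<in> (\<lambda>h. h i) -` V"
    "(\<lambda>h. h i) -` U \<inter> (\<lambda>h. h i) -` V = {}" by (simp_all add: vimage_Int[symmetric])
  with open_coordinate_vimage[OF U] open_coordinate_vimage[OF V]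
  show "\<exists>U V. open U \<and> open V \<and> f \<in> U \<and> g \<in> V \<and> U \<inter> V = {}"
    by metis
qed

text \<open>Tychonoff's theorem, transferred from the abstract product topology to the type class
  topology on functions.\<close>

lemma compact_Pi_UNIV:
  fixes S :: "'a \<Rightarrow> 'b::topological_space set"
  assumes "\<And>i. compact (S i)"
  shows "compact {f. \<forall>i. f i \<in> S i}"
proof -
  have "{f. \<forall>i. f i \<in> S i} = PiE UNIV S" by (auto simp: PiE_UNIV_domain)
  then show ?thesis
    using compactin_PiE[of "\<lambda>_. euclidean" UNIV S] assms
    by (simp add: euclidean_product_topology)
qed

section \<open>Regular Borel measures from finitely additive ones\<close>

lemma Hausdorff_space_t2: "Hausdorff_space (euclidean :: 'b::t2_space topology)"
  unfolding Hausdorff_space_def disjnt_def by (simp add: separation_t2)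

text \<open>A finitely additive probability concentrated on the compact set \<open>C\<close>. It is
  defined on all subsets, so every instance of an axiom is a closed condition on finitely many
  values, and such set functions form a compact subset of a product of intervals.\<close>

locale compact_content =
  fixes \<nu> :: "'b::t2_space set \<Rightarrow> real" and C :: "'b set"
  assumes nonneg: "0 \<le> \<nu> A"
    and Un_disjoint: "A \<inter> B = {} \<Longrightarrow> \<nu> (A \<union> B) = \<nu> A + \<nu> B"
    and compl_null: "\<nu> (- C) = 0"
    and total: "\<nu> C = 1"
    and compact: "compact C"
begin

lemma mono: "A \<subseteq> B \<Longrightarrow> \<nu> A \<le> \<nu> B"
  using Un_disjoint[of A "B - A"] nonneg[of "B - A"] by (auto simp: Un_absorb1)

lemma empty: "\<nu> {} = 0"
  using Un_disjoint[of "{}" "{}"] by simp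

lemma subadditive: "\<nu> (A \<union> B) \<le> \<nu> A + \<nu> B"
  using Un_disjoint[of A "B - A"] mono[of "B - A" B] by auto

lemma Int_support: "\<nu> (A \<inter> C) = \<nu> A"
proof -
  have "\<nu> A \<le> \<nu> (A \<inter> C) + \<nu> (- C)"
    using subadditive[of "A \<inter> C" "- C"] mono[of A "A \<inter> C \<union> - C"] by fastforce
  with mono[of "A \<inter> C" A] compl_null show ?thesis by auto
qed

text \<open>Approximating open sets by compact sets from inside is what replaces the missing
  countable additivity of \<open>\<nu>\<close>.\<close>

definition inner_content :: "'b set \<Rightarrow> ennreal" where
  "inner_content U = (SUP D\<in>{D. compact D \<and> D \<subseteq> U}. ennreal (\<nu> D))"

definition outer_content :: "'b set \<Rightarrow> ennreal" where
  "outer_content A = (INF U\<in>{U. open U \<and> A \<subseteq> U}. inner_content U)"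

lemma inner_content_mono: "U \<subseteq> V \<Longrightarrow> inner_content U \<le> inner_content V"
  unfolding inner_content_def by (rule SUP_subset_mono) auto

lemma inner_content_ge: "compact D \<Longrightarrow> D \<subseteq> U \<Longrightarrow> ennreal (\<nu> D) \<le> inner_content U"
  unfolding inner_content_def by (rule SUP_upper) auto

lemma inner_content_empty: "inner_content {} = 0"
  unfolding inner_content_def by (auto simp: empty cong: conj_cong)

text \<open>Separating \<open>D - U\<close> from \<open>D - V\<close> by disjoint open sets
  \<open>P\<close> and \<open>Q\<close> writes the compact \<open>D\<close> as the union of the
  compact sets \<open>D - P\<close>, inside \<open>U\<close>, and \<open>D - Q\<close>, inside
  \<open>V\<close>.\<close>

lemma inner_content_Un:
  assumes "open U" "open V"
  shows "inner_content (U \<union> V) \<le> inner_content U + inner_content V"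
  unfolding inner_content_def[of "U \<union> V"]
proof (rule SUP_least, clarify)
  fix D assume D: "compact D" "D \<subseteq> U \<union> V"
  have "compact (D - U)" "compact (D - V)"
    using D assms by (auto simp: compact_diff)
  moreover have "disjnt (D - U) (D - V)" using D by (auto simp: disjnt_def)
  ultimately obtain P Q where PQ: "open P" "open Q" "D - U \<subseteq> P" "D - V \<subseteq> Q" "disjnt P Q"
    using Hausdorff_space_compact_separation[OF Hausdorff_space_t2, of "D - U" "D - V"]
    by auto
  have "\<nu> D \<le> \<nu> (D - P) + \<nu> (D - Q)"
    using subadditive[of "D - P" "D - Q"] mono[of D "(D - P) \<union> (D - Q)"] PQ
    by (force simp: disjnt_def)
  then have "ennreal (\<nu> D) \<le> ennreal (\<nu> (D - P)) + ennreal (\<nu> (D - Q))"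
    by (metis ennreal_leI ennreal_plus nonneg)
  also have "\<dots> \<le> inner_content U + inner_content V"
    using D PQ by (intro add_mono inner_content_ge) (auto simp: compact_diff)
  finally show "ennreal (\<nu> D) \<le> inner_content U + inner_content V" .
qed

lemma inner_content_UN_finite:
  assumes "\<And>i::nat. open (U i)" "finite I"
  shows "inner_content (\<Union>i\<in>I. U i) \<le> (\<Sum>i\<in>I. inner_content (U i))"
  using assms(2)
proof induction
  case (insert i I)
  have "inner_content (\<Union>i\<in>insert i I. U i) \<le> inner_content (U i) + inner_content (\<Union>i\<in>I. U i)"
    using inner_content_Un[of "U i" "\<Union>i\<in>I. U i"] assms by auto
  also have "\<dots> \<le> inner_content (U i) + (\<Sum>i\<in>I. inner_content (U i))"
    using insert by (intro add_mono) auto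
  finally show ?case using insert by simp
qed (simp add: inner_content_empty)

text \<open>A compact set inside the union is covered by finitely many of the open sets, so finite
  subadditivity already yields the countable one.\<close>

lemma inner_content_UN:
  assumes "\<And>i::nat. open (U i)"
  shows "inner_content (\<Union>i. U i) \<le> (\<Sum>i. inner_content (U i))"
  unfolding inner_content_def[of "\<Union>i. U i"]
proof (rule SUP_least, clarify)
  fix D assume D: "compact D" "D \<subseteq> (\<Union>i. U i)"
  obtain I where I: "finite I" "D \<subseteq> (\<Union>i\<in>I. U i)"
    using compactE_image[OF D(1) _ D(2)] assms by metis
  have "ennreal (\<nu> D) \<le> inner_content (\<Union>i\<in>I. U i)" using D I by (intro inner_content_ge)
  also have "\<dots> \<le> (\<Sum>i\<in>I. inner_content (U i))" using assms I by (intro inner_content_UN_finite)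
  also have "\<dots> \<le> (\<Sum>i. inner_content (U i))" using I by (intro sum_le_suminf) auto
  finally show "ennreal (\<nu> D) \<le> (\<Sum>i. inner_content (U i))" .
qed

lemma outer_content_open: "open U \<Longrightarrow> outer_content U = inner_content U"
  unfolding outer_content_def
  by (intro antisym INF_lower INF_greatest) (auto intro: inner_content_mono)

lemma outer_content_le: "open U \<Longrightarrow> A \<subseteq> U \<Longrightarrow> outer_content A \<le> inner_content U"
  unfolding outer_content_def by (rule INF_lower) auto

lemma outer_content_mono: "A \<subseteq> B \<Longrightarrow> outer_content A \<le> outer_content B"
  unfolding outer_content_def by (rule INF_superset_mono) auto

lemma outer_content_empty: "outer_content {} = 0"
  by (simp add: outer_content_open inner_content_empty)

lemma outer_content_UN: "outer_content (\<Union>i::nat. A i) \<le> (\<Sum>i. outer_content (A i))"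
proof (rule ennreal_le_epsilon)
  fix e :: real assume e: "0 < e" and fin: "(\<Sum>i. outer_content (A i)) < top"
  \<comment> \<open>A finite sum has finite terms, so adding a positive error increases each of them
    strictly; the errors \<open>e / 2 ^ (n + 1)\<close> add up to \<open>e\<close>.\<close>
  then have *: "outer_content (A n) < outer_content (A n) + e * (1/2) ^ Suc n" for n
    by (auto simp add: less_top dest!: ennreal_suminf_lessD)
  have "\<exists>U. open U \<and> A n \<subseteq> U \<and> inner_content U \<le> outer_content (A n) + e * (1/2) ^ Suc n" for n
    using *[of n] unfolding outer_content_def[of "A n"] INF_less_iff by (auto intro: less_imp_le)
  then obtain U where U: "\<And>n. open (U n)" "\<And>n. A n \<subseteq> U n"
    "\<And>n. inner_content (U n) \<le> outer_content (A n) + e * (1/2) ^ Suc n" by metis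
  have "outer_content (\<Union>i. A i) \<le> inner_content (\<Union>i. U i)"
    using U by (intro outer_content_le) auto
  also have "\<dots> \<le> (\<Sum>i. inner_content (U i))" using U by (intro inner_content_UN)
  also have "\<dots> \<le> (\<Sum>n. outer_content (A n) + e * (1/2) ^ Suc n)"
    using U by (intro suminf_le) auto
  also have "\<dots> = (\<Sum>n. outer_content (A n)) + (\<Sum>n. ennreal e * ennreal ((1/2) ^ Suc n))"
    using e by (subst suminf_add[symmetric])
               (auto simp del: ennreal_suminf_cmult simp add: ennreal_mult[symmetric])
  also have "\<dots> = (\<Sum>n. outer_content (A n)) + e"
    unfolding ennreal_suminf_cmult
    by (subst suminf_ennreal_eq[OF zero_le_power power_half_series]) auto
  finally show "outer_content (\<Union>i. A i) \<le> (\<Sum>i. outer_content (A i)) + e" .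
qed

section \<open>Caratheodory measurability of the open sets\<close>

lemma outer_measure_space: "outer_measure_space (Pow UNIV) outer_content"
  unfolding outer_measure_space_def positive_def increasing_def countably_subadditive_def
  by (auto simp: outer_content_empty outer_content_mono outer_content_UN)

lemma outer_content_Un: "outer_content (A \<union> B) \<le> outer_content A + outer_content B"
proof -
  have "outer_content (\<Union>i. binaryset A B i) \<le> (\<Sum>i. outer_content (binaryset A B i))" by (rule outer_content_UN)
  then show ?thesis
    by (simp add: UN_binaryset_eq suminf_binaryset_eq outer_content_empty)
qed

text \<open>A compact \<open>D\<close> inside \<open>V \<inter> U\<close> leaves the open set
  \<open>V - D\<close> around \<open>V - U\<close>. Compact sets inside \<open>V - D\<close> are
  disjoint from \<open>D\<close>, so additivity of \<open>\<nu>\<close> bounds the two contents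
  together by that of \<open>V\<close>.\<close>

lemma outer_content_split_open:
  assumes "open U" "open V"
  shows "outer_content (V \<inter> U) + outer_content (V - U) \<le> inner_content V"
proof -
  have *: "ennreal (\<nu> D) + outer_content (V - U) \<le> inner_content V" if D: "compact D" "D \<subseteq> V \<inter> U" for D
  proof -
    have "outer_content (V - U) \<le> inner_content (V - D)"
      using D assms by (intro outer_content_le) (auto intro: open_Diff compact_imp_closed)
    then have "ennreal (\<nu> D) + outer_content (V - U) \<le> ennreal (\<nu> D) + inner_content (V - D)"
      by (rule add_left_mono)
    also have "\<dots> = (SUP D'\<in>{D'. compact D' \<and> D' \<subseteq> V - D}. ennreal (\<nu> D) + ennreal (\<nu> D'))"
      unfolding inner_content_def by (rule ennreal_SUP_add_right) auto
    also have "\<dots> \<le> inner_content V"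
    proof (rule SUP_least, clarify)
      fix D' assume D': "compact D'" "D' \<subseteq> V - D"
      then have "D \<inter> D' = {}" by auto
      then have "ennreal (\<nu> D) + ennreal (\<nu> D') = ennreal (\<nu> (D \<union> D'))"
        by (simp add: Un_disjoint nonneg)
      also have "\<dots> \<le> inner_content V" using D D' by (intro inner_content_ge) (auto intro: compact_Un)
      finally show "ennreal (\<nu> D) + ennreal (\<nu> D') \<le> inner_content V" .
    qed
    finally show ?thesis .
  qed
  have "outer_content (V \<inter> U) + outer_content (V - U) =
      (SUP D\<in>{D. compact D \<and> D \<subseteq> V \<inter> U}. ennreal (\<nu> D) + outer_content (V - U))"
    using assms unfolding outer_content_open[OF open_Int[OF assms(2,1)]] inner_content_def
    by (intro ennreal_SUP_add_left[symmetric]) auto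
  also have "\<dots> \<le> inner_content V" using * by (intro SUP_least) auto
  finally show ?thesis .
qed

text \<open>The infimum defining the outer content of a test set \<open>A\<close> runs over open
  sets, so splitting open test sets is enough.\<close>

lemma open_lambda_system:
  assumes "open U"
  shows "U \<in> lambda_system UNIV (Pow UNIV) outer_content"
  unfolding lambda_system_def
proof (clarsimp)
  fix A
  have "outer_content (U \<inter> A) + outer_content (- U \<inter> A) \<le> outer_content A"
    unfolding outer_content_def[of A]
  proof (rule INF_greatest, clarify)
    fix V assume V: "open V" "A \<subseteq> V"
    have "outer_content (U \<inter> A) + outer_content (- U \<inter> A) \<le> outer_content (V \<inter> U) + outer_content (V - U)"
      using V by (intro add_mono outer_content_mono) auto
    with outer_content_split_open[OF assms V(1)] show "outer_content (U \<inter> A) + outer_content (- U \<inter> A) \<le> inner_content V"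
      by (rule order_trans[rotated])
  qed
  moreover have "outer_content A \<le> outer_content (U \<inter> A) + outer_content (- U \<inter> A)"
    using outer_content_Un[of "U \<inter> A" "- U \<inter> A"] by (simp add: Int_Un_distrib2[symmetric])
  ultimately show "outer_content (U \<inter> A) + outer_content ((UNIV - U) \<inter> A) = outer_content A"
    by (simp add: Compl_eq_Diff_UNIV)
qed

section \<open>The Borel extension and its regularity\<close>

definition borel_extension :: "'b measure" where
  "borel_extension = measure_of UNIV {S. open S} outer_content"

lemma sets_borel_extension [measurable_cong]: "sets borel_extension = sets borel"
  by (simp add: borel_extension_def borel_def sets_measure_of)

lemma space_borel_extension [simp]: "space borel_extension = UNIV"
  by (simp add: borel_extension_def space_measure_of)

lemma emeasure_borel_extension:
  assumes "A \<in> sets borel"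
  shows "emeasure borel_extension A = outer_content A"
proof -
  have ms: "measure_space UNIV (lambda_system UNIV (Pow UNIV) outer_content) outer_content"
    using sigma_algebra.caratheodory_lemma[OF sigma_algebra_Pow outer_measure_space] .
  then interpret L: sigma_algebra UNIV "lambda_system UNIV (Pow UNIV) outer_content"
    by (simp add: measure_space_def)
  have "sigma_sets UNIV {S. open S} \<subseteq> lambda_system UNIV (Pow UNIV) outer_content"
    by (rule L.sigma_sets_subset) (blast intro: open_lambda_system)
  then have "measure_space UNIV (sigma_sets UNIV {S. open S}) outer_content"
    using ms by (rule_tac measure_down[OF ms]) (auto intro!: sigma_algebra_sigma_sets)
  with assms show ?thesis
    unfolding borel_extension_def
    by (intro emeasure_measure_of[OF refl]) (auto simp: measure_space_def sets_measure_of borel_def)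
qed

lemma inner_content_UNIV: "inner_content UNIV = 1"
proof (rule antisym)
  show "inner_content UNIV \<le> 1"
    unfolding inner_content_def
  proof (rule SUP_least, clarify)
    fix D :: "'b set"
    have "\<nu> D \<le> 1" using mono[of "D \<inter> C" C] by (simp add: Int_support total)
    then show "ennreal (\<nu> D) \<le> 1" by simp
  qed
  show "1 \<le> inner_content UNIV" using inner_content_ge[OF compact, of UNIV] by (simp add: total)
qed

lemma prob_space_borel_extension: "prob_space borel_extension"
  by (rule prob_spaceI) (simp add: emeasure_borel_extension outer_content_open inner_content_UNIV)

sublocale P: prob_space borel_extension
  by (rule prob_space_borel_extension)

text \<open>The compact set \<open>F \<inter> C\<close> carries the whole content of
  \<open>F\<close> and lies in every open set around \<open>F\<close>. The extension may enlarge
  closed sets; this one-sided bound is the one used for barycentres.\<close>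

lemma closed_le:
  assumes "closed F"
  shows "\<nu> F \<le> measure borel_extension F"
proof -
  have "ennreal (\<nu> F) \<le> inner_content U" if "F \<subseteq> U" for U
    using inner_content_ge[of "F \<inter> C" U] assms that compact by (auto simp: Int_support closed_Int_compact)
  then have "ennreal (\<nu> F) \<le> emeasure borel_extension F"
    using assms by (auto simp: emeasure_borel_extension outer_content_def intro: INF_greatest)
  then show ?thesis
    using nonneg by (simp add: P.emeasure_eq_measure)
qed

lemma measure_support: "measure borel_extension C = 1"
  using closed_le[OF compact_imp_closed[OF compact]] P.prob_le_1[of C] by (simp add: total)

lemma outer_regular:
  assumes A: "A \<in> sets borel" and e: "0 < (e::real)"
  shows "\<exists>U. open U \<and> A \<subseteq> U \<and> measure borel_extension U < measure borel_extension A + e"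
proof -
  have "outer_content A < ennreal (measure borel_extension A + e)"
    using A e by (simp add: emeasure_borel_extension[symmetric] P.emeasure_eq_measure)
  then obtain U where U: "open U" "A \<subseteq> U" "inner_content U < ennreal (measure borel_extension A + e)"
    unfolding outer_content_def INF_less_iff by auto
  then have "emeasure borel_extension U < ennreal (measure borel_extension A + e)"
    by (simp add: emeasure_borel_extension outer_content_open)
  then show ?thesis using U by (auto simp: P.emeasure_eq_measure ennreal_less_iff)
qed

text \<open>Outer regularity of the complement: an open \<open>U\<close> around \<open>- A\<close>
  of nearly the same measure leaves the compact set \<open>C - U\<close> inside \<open>A\<close>,
  and nothing is lost outside \<open>C\<close>, which has full measure.\<close>

lemma inner_regular:
  assumes A: "A \<in> sets borel" and e: "0 < (e::real)"
  shows "\<exists>D. compact D \<and> D \<subseteq> A \<inter> C \<and> measure borel_extension A < measure borel_extension D + e"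
proof -
  have A': "A \<in> P.events" "C \<in> P.events" using A compact_imp_closed[OF compact] by (auto simp: sets_borel_extension)
  obtain U where U: "open U" "- A \<subseteq> U"
    "measure borel_extension U < measure borel_extension (- A) + e"
    using outer_regular[of "- A" e] A e by auto
  have *: "compact (C - U)" using U compact by (simp add: compact_diff)
  have "measure borel_extension (C - U) = measure borel_extension (- U)"
  proof (rule antisym)
    have "measure borel_extension (- U) \<le> measure borel_extension ((C - U) \<union> - C)"
      using U(1) A' by (intro P.finite_measure_mono) (auto simp: sets_borel_extension)
    also have "\<dots> \<le> measure borel_extension (C - U) + measure borel_extension (- C)"
      using U(1) A' by (intro measure_Un_le) (auto simp: sets_borel_extension)
    also have "measure borel_extension (- C) = 0"
      using measure_support P.prob_compl[of C] A' by (simp add: Compl_eq_Diff_UNIV)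
    finally show "measure borel_extension (- U) \<le> measure borel_extension (C - U)" by simp
    show "measure borel_extension (C - U) \<le> measure borel_extension (- U)"
      using U(1) A' by (intro P.finite_measure_mono) (auto simp: sets_borel_extension)
  qed
  also have "\<dots> = 1 - measure borel_extension U"
    using P.prob_compl[of U] U by (simp add: Compl_eq_Diff_UNIV sets_borel_extension)
  also have "\<dots> > measure borel_extension A - e"
    using U(3) P.prob_compl[of A] A' by (simp add: Compl_eq_Diff_UNIV)
  finally show ?thesis using * U(2) by (intro exI[of _ "C - U"]) auto
qed

end

section \<open>Separation and extreme points\<close>

lemma continuous_on_coordinate: "continuous_on S (\<lambda>x :: 'a \<Rightarrow> 'b::topological_space. x a)"
  by (rule continuous_on_subset[OF continuous_on_product_coordinates]) simp

lemma continuous_on_linear: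
  fixes g :: "'a \<Rightarrow> real"
  shows "continuous_on S (\<lambda>x. \<Sum>a\<in>F. g a * x a)"
  by (rule continuous_on_sum, rule continuous_on_mult[OF continuous_on_const continuous_on_coordinate])

lemma fconvexD:
  "fconvex K \<Longrightarrow> x \<in> K \<Longrightarrow> y \<in> K \<Longrightarrow> 0 \<le> t \<Longrightarrow> t \<le> 1 \<Longrightarrow> (\<lambda>a. (1 - t) * x a + t * y a) \<in> K"
  unfolding fconvex_def by blast

lemma open_fun_finite_coordinates:
  fixes U :: "('a \<Rightarrow> 'b::topological_space) set"
  assumes "open U" "x \<in> U"
  shows "\<exists>V. finite {a. V a \<noteq> UNIV} \<and> (\<forall>a. open (V a)) \<and> (\<forall>a. x a \<in> V a) \<and>
    (\<forall>y. (\<forall>a. y a \<in> V a) \<longrightarrow> y \<in> U)"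
proof -
  have "openin (product_topology (\<lambda>i. euclidean) UNIV) U"
    using assms(1) by (simp add: open_fun_def)
  from product_topology_open_contains_basis[OF this assms(2)]
  obtain V where V: "x \<in> PiE UNIV V" "\<And>i. open (V i)" "finite {i. V i \<noteq> UNIV}" "PiE UNIV V \<subseteq> U"
    by auto
  show ?thesis by (intro exI[of _ V]) (use V in \<open>auto simp: PiE_UNIV_domain\<close>)
qed

text \<open>The separating functional is the difference to a nearest point of \<open>H\<close>, with distance
  measured on the finitely many coordinates that already tell \<open>s\<close> apart from \<open>H\<close>.\<close>

lemma separation_compact_convex:
  fixes H :: "('a \<Rightarrow> real) set"
  assumes H: "compact H" "fconvex H" "s \<notin> H"
  obtains F g c where "finite F" "\<And>y. y \<in> H \<Longrightarrow> (\<Sum>a\<in>F. g a * y a) \<le> c" "c < (\<Sum>a\<in>F. g a * s a)"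
proof (cases "H = {}")
  case True
  \<comment> \<open>With nothing to bound, the empty sum at \<open>s\<close> already exceeds
    \<open>- 1\<close>.\<close>
  show thesis by (rule that[of "{}" "\<lambda>_. 0" "-1"]) (auto simp: True)
next
  case False
  have "open (- H)" using H by (auto intro: compact_imp_closed)
  have "s \<in> - H" using H(3) by simp
  from open_fun_finite_coordinates[OF \<open>open (- H)\<close> this]
  obtain V where V: "finite {a. V a \<noteq> UNIV}" "\<forall>a. s a \<in> V a" "\<forall>y. (\<forall>a. y a \<in> V a) \<longrightarrow> y \<in> - H"
    by (elim exE conjE)
  define F where "F = {a. V a \<noteq> UNIV}"
  have fF: "finite F" using V(1) F_def by simp
  have diff: "\<exists>a\<in>F. y a \<noteq> s a" if "y \<in> H" for y
  proof (rule ccontr)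
    assume "\<not> ?thesis"
    then have "y a \<in> V a" for a using V(2) unfolding F_def by (cases "V a = UNIV") auto
    then show False using V(3) that by blast
  qed
  define \<phi> where "\<phi> y = (\<Sum>a\<in>F. (y a - s a)\<^sup>2)" for y :: "'a \<Rightarrow> real"
  have "continuous_on H \<phi>"
    unfolding \<phi>_def by (intro continuous_intros continuous_on_coordinate)
  then obtain y0 where y0: "y0 \<in> H" "\<And>y. y \<in> H \<Longrightarrow> \<phi> y0 \<le> \<phi> y"
    using continuous_attains_inf[OF H(1) False] by blast
  define g where "g a = s a - y0 a" for a
  define c where "c = (\<Sum>a\<in>F. g a * y0 a)"
  have pos: "0 < \<phi> y0"
  proof -
    obtain a where "a \<in> F" "y0 a \<noteq> s a" using diff[OF y0(1)] by auto
    then show ?thesis unfolding \<phi>_def using fF by (intro sum_pos2[of F a]) auto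
  qed
  show thesis
  proof (rule that[of F g c, OF fF])
    have "(\<Sum>a\<in>F. g a * s a) - c = \<phi> y0"
      unfolding c_def \<phi>_def g_def sum_subtractf[symmetric]
      by (intro sum.cong) (auto simp: power2_eq_square algebra_simps)
    then show "c < (\<Sum>a\<in>F. g a * s a)" using pos by simp
    fix y assume y: "y \<in> H"
    define B where "B = (\<Sum>a\<in>F. (y a - y0 a) * (y0 a - s a))"
    define Q where "Q = (\<Sum>a\<in>F. (y a - y0 a)\<^sup>2)"
    have Q: "0 \<le> Q" unfolding Q_def by (rule sum_nonneg) auto
    \<comment> \<open>Minimality of \<open>y0\<close> along the segment from \<open>y0\<close> to
      \<open>y\<close>, expanded as a quadratic in \<open>t\<close>.\<close>
    have le: "0 \<le> 2 * t * B + t\<^sup>2 * Q" if t: "0 \<le> t" "t \<le> 1" for t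
    proof -
      have "\<phi> (\<lambda>a. (1 - t) * y0 a + t * y a) = \<phi> y0 + (2 * t * B + t\<^sup>2 * Q)"
        unfolding \<phi>_def B_def Q_def sum_distrib_left sum.distrib[symmetric]
        by (intro sum.cong) (auto simp: power2_eq_square algebra_simps)
      with y0(2)[OF fconvexD[OF H(2) y0(1) y t]] show ?thesis by simp
    qed
    have "0 \<le> B"
    proof (rule ccontr)
      assume "\<not> 0 \<le> B"
      then have B: "B < 0" by simp
      \<comment> \<open>If \<open>B < 0\<close>, the linear term wins for small \<open>t\<close>.
        This choice gives \<open>t * Q \<le> - B\<close>, half of what the linear term can pay for;
        \<open>Q + 1\<close> avoids division by zero.\<close>
      define t where "t = min 1 (- B / (Q + 1))"
      have t: "0 < t" "t \<le> 1" using B Q by (auto simp: t_def divide_neg_pos)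
      have "t * Q \<le> - B / (Q + 1) * Q" using Q by (intro mult_right_mono) (auto simp: t_def)
      also have "\<dots> \<le> - B" using B Q by (simp add: field_simps)
      finally have "2 * B + t * Q < 0" using B by linarith
      with t have "t * (2 * B + t * Q) < 0" by (simp add: mult_pos_neg)
      then show False using le[of t] t by (simp add: power2_eq_square algebra_simps)
    qed
    moreover have "(\<Sum>a\<in>F. g a * y a) - c = - B"
      unfolding c_def B_def g_def sum_subtractf[symmetric] sum_negf[symmetric]
      by (intro sum.cong) (auto simp: algebra_simps)
    ultimately show "(\<Sum>a\<in>F. g a * y a) \<le> c" by simp
  qed
qed

section \<open>Closed extremal sets and the Krein-Milman argument\<close>

definition closed_face :: "('a \<Rightarrow> real) set \<Rightarrow> ('a \<Rightarrow> real) set \<Rightarrow> bool" where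
  "closed_face K L \<longleftrightarrow> L \<noteq> {} \<and> closed L \<and> L \<subseteq> K \<and>
     (\<forall>x\<in>L. \<forall>y\<in>K. \<forall>z\<in>K. \<forall>t. 0 < t \<and> t < 1 \<and> x = (\<lambda>a. t * y a + (1 - t) * z a) \<longrightarrow> y \<in> L \<and> z \<in> L)"

lemma closed_faceD:
  assumes "closed_face K L"
  shows "L \<noteq> {}" "closed L" "L \<subseteq> K"
  using assms unfolding closed_face_def by simp_all

text \<open>If a maximizer is a proper convex combination of \<open>y\<close> and \<open>z\<close>,
  both lie in \<open>L\<close>, and by affinity their nonnegative deficits from the maximum average
  to zero. So both deficits vanish.\<close>

lemma closed_face_maximizers:
  assumes K: "compact K" and L: "closed_face K L"
    and cont: "continuous_on UNIV \<phi>"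
    and lin: "\<And>y z t. \<phi> (\<lambda>a. t * y a + (1 - t) * z a) = t * \<phi> y + (1 - t) * \<phi> z"
  shows "closed_face K {x \<in> L. \<forall>y\<in>L. \<phi> y \<le> (\<phi> x :: real)}"
  unfolding closed_face_def
proof (intro conjI ballI allI impI)
  let ?M = "{x \<in> L. \<forall>y\<in>L. \<phi> y \<le> \<phi> x}"
  have "compact L" using compact_Int_closed[OF K, of L]
    using closed_faceD[OF L] by (simp add: Int_absorb1)
  moreover have "L \<noteq> {}" "continuous_on L \<phi>"
    using closed_faceD(1)[OF L] continuous_on_subset[OF cont] by simp_all
  ultimately obtain x where "x \<in> L" "\<forall>y\<in>L. \<phi> y \<le> \<phi> x"
    using continuous_attains_sup by blast
  then show "?M \<noteq> {}" by blast
  have "closed (\<Inter>y\<in>L. {x. \<phi> y \<le> \<phi> x})"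
    by (rule closed_INT, rule ballI, rule closed_Collect_le[OF continuous_on_const cont])
  then have "closed (L \<inter> (\<Inter>y\<in>L. {x. \<phi> y \<le> \<phi> x}))"
    by (rule closed_Int[OF closed_faceD(2)[OF L]])
  moreover have "?M = L \<inter> (\<Inter>y\<in>L. {x. \<phi> y \<le> \<phi> x})" by blast
  ultimately show "closed ?M" by (simp only:)
  show "?M \<subseteq> K" using closed_faceD(3)[OF L] by blast
  fix x y z t
  assume x: "x \<in> ?M" and yz: "y \<in> K" "z \<in> K"
    and "0 < t \<and> t < 1 \<and> x = (\<lambda>a. t * y a + (1 - t) * z a)"
  then have t: "0 < t" "t < 1" and xt: "x = (\<lambda>a. t * y a + (1 - t) * z a)" by auto
  have yzL: "y \<in> L" "z \<in> L"
    using L x yz t xt unfolding closed_face_def by blast+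
  have "\<forall>y\<in>L. \<phi> y \<le> \<phi> x" using x by blast
  then have le: "\<phi> y \<le> \<phi> x" "\<phi> z \<le> \<phi> x" using yzL by blast+
  have eq: "t * (\<phi> x - \<phi> y) + (1 - t) * (\<phi> x - \<phi> z) = 0"
    using lin[of t y z] xt by (simp add: algebra_simps)
  moreover have "0 \<le> t * (\<phi> x - \<phi> y)" "0 \<le> (1 - t) * (\<phi> x - \<phi> z)" using t le by auto
  ultimately have "t * (\<phi> x - \<phi> y) = 0" "(1 - t) * (\<phi> x - \<phi> z) = 0" by linarith+
  then have "\<phi> y = \<phi> x" "\<phi> z = \<phi> x" using t by auto
  then show "y \<in> ?M" "z \<in> ?M" using \<open>\<forall>y\<in>L. \<phi> y \<le> \<phi> x\<close> yzL by simp_all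
qed

text \<open>Nonemptiness comes from the finite intersection property: a nonempty finite subfamily of
  a chain has its intersection as a member, and members are nonempty.\<close>

lemma closed_face_Inter:
  assumes "compact K" "\<C> \<noteq> {}" and ch: "\<And>L M. L \<in> \<C> \<Longrightarrow> M \<in> \<C> \<Longrightarrow> L \<subseteq> M \<or> M \<subseteq> L"
    and fc: "\<And>L. L \<in> \<C> \<Longrightarrow> closed_face K L"
  shows "closed_face K (\<Inter>\<C>)"
  unfolding closed_face_def
proof (intro conjI ballI allI impI)
  have "K \<inter> \<Inter>\<C> \<noteq> {}"
  proof (rule compact_imp_fip[OF assms(1)])
    show "closed T" if "T \<in> \<C>" for T by (rule closed_faceD(2)[OF fc[OF that]])
    show "K \<inter> \<Inter>\<D> \<noteq> {}" if D: "finite \<D>" "\<D> \<subseteq> \<C>" for \<D>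
    proof (cases "\<D> = {}")
      case True
      then show ?thesis using assms(2) closed_faceD(1,3)[OF fc] by fastforce
    next
      case False
      have "\<Inter>\<D> \<in> \<D>" using D(1) False D(2)
      proof (induction rule: finite_ne_induct)
        case (insert L \<D>)
        then have "L \<subseteq> \<Inter>\<D> \<or> \<Inter>\<D> \<subseteq> L" using ch[of L "\<Inter>\<D>"] by blast
        then show ?case
        proof
          assume "L \<subseteq> \<Inter>\<D>" then show ?thesis by (simp add: Int_absorb2)
        next
          assume "\<Inter>\<D> \<subseteq> L" then show ?thesis using insert by (simp add: Int_absorb1)
        qed
      qed simp
      then have "closed_face K (\<Inter>\<D>)" using D fc by blast
      then show ?thesis using closed_faceD(1,3)[of K "\<Inter>\<D>"] by blast
    qed
  qed
  then show "\<Inter>\<C> \<noteq> {}" by auto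
  show "closed (\<Inter>\<C>)" using closed_faceD(2)[OF fc] by (intro closed_Inter) blast
  show "\<Inter>\<C> \<subseteq> K" using assms(2) closed_faceD(3)[OF fc] by blast
  fix x y z t
  assume "x \<in> \<Inter>\<C>" "y \<in> K" "z \<in> K" "0 < t \<and> t < 1 \<and> x = (\<lambda>a. t * y a + (1 - t) * z a)"
  then have "y \<in> L \<and> z \<in> L" if "L \<in> \<C>" for L
    using fc[OF that] that unfolding closed_face_def by (metis InterD)
  then show "y \<in> \<Inter>\<C>" "z \<in> \<Inter>\<C>" by auto
qed

text \<open>Zorn's lemma gives a minimal closed face inside \<open>L0\<close>. The maximizers of a
  coordinate form a closed face of it, so by minimality every coordinate is constant there. A face
  with a single point is an extreme point.\<close>

lemma closed_face_contains_extreme: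
  assumes K: "compact K" and L0: "closed_face K L0"
  shows "L0 \<inter> fextreme_points K \<noteq> {}"
proof -
  \<comment> \<open>Complements turn the search for a minimal face into one for a maximal
    set.\<close>
  define \<A> where "\<A> = {- L |L. closed_face K L \<and> L \<subseteq> L0}"
  have "\<exists>M\<in>\<A>. \<forall>N\<in>\<A>. M \<subseteq> N \<longrightarrow> N = M"
  proof (rule subset_Zorn_nonempty)
    show "\<A> \<noteq> {}" using L0 by (auto simp: \<A>_def)
    fix \<C> assume \<C>: "\<C> \<noteq> {}" "subset.chain \<A> \<C>"
    have mem: "closed_face K L \<and> L \<subseteq> L0" if "- L \<in> \<C>" for L
      using \<C>(2) that by (auto simp: subset_chain_def \<A>_def)
    have "closed_face K (\<Inter>(uminus ` \<C>))"
    proof (rule closed_face_Inter[OF K])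
      show "uminus ` \<C> \<noteq> {}" using \<C>(1) by simp
      show "closed_face K L" if "L \<in> uminus ` \<C>" for L
        using that mem[of L] by auto
      show "L \<subseteq> M \<or> M \<subseteq> L" if "L \<in> uminus ` \<C>" "M \<in> uminus ` \<C>" for L M
        using that \<C>(2) by (auto simp: subset_chain_def)
    qed
    moreover have "\<Inter>(uminus ` \<C>) \<subseteq> L0"
    proof -
      obtain N where "N \<in> \<C>" using \<C>(1) by auto
      then show ?thesis using mem[of "- N"] by auto
    qed
    moreover have "\<Union>\<C> = - \<Inter>(uminus ` \<C>)" by auto
    ultimately show "\<Union>\<C> \<in> \<A>" unfolding \<A>_def by blast
  qed
  then obtain N where N: "N \<in> \<A>" and maxN: "\<And>M. M \<in> \<A> \<Longrightarrow> N \<subseteq> M \<Longrightarrow> M = N"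
    by metis
  then obtain L where NL: "N = - L" and L: "closed_face K L" "L \<subseteq> L0"
    unfolding \<A>_def by auto
  have min: "M = L" if M: "closed_face K M" "M \<subseteq> L" for M
  proof -
    have "- M \<in> \<A>" using M L(2) unfolding \<A>_def mem_Collect_eq by (intro exI[of _ M]) auto
    then have "- M = N" by (rule maxN) (use M(2) NL in auto)
    then have "- M = - L" using NL by simp
    then show ?thesis by simp
  qed
  obtain x where x: "x \<in> L" using closed_faceD(1)[OF L(1)] by blast
  have const: "p a = q a" if "p \<in> L" "q \<in> L" for p q a
  proof -
    have "closed_face K {x \<in> L. \<forall>y\<in>L. y a \<le> x a}"
      by (rule closed_face_maximizers[OF K L(1) continuous_on_coordinate]) simp
    then have "{x \<in> L. \<forall>y\<in>L. y a \<le> x a} = L" by (rule min) blast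
    with that have "p \<in> {x \<in> L. \<forall>y\<in>L. y a \<le> x a}" "q \<in> {x \<in> L. \<forall>y\<in>L. y a \<le> x a}"
      by (simp_all only:)
    then show ?thesis using that by (blast intro: antisym)
  qed
  have "L = {x}"
  proof -
    have "y = x" if "y \<in> L" for y
    proof
      show "y a = x a" for a by (rule const[OF that x])
    qed
    with x show ?thesis by blast
  qed
  then have "x \<in> fextreme_points K"
    using L(1) unfolding closed_face_def fextreme_points_def by blast
  then show ?thesis using L(2) x by auto
qed

text \<open>Bauer's maximum principle for linear functionals: the maximizers form a closed
  face.\<close>

lemma extreme_point_maximizer:
  fixes g :: "'a \<Rightarrow> real"
  assumes K: "compact K" "K \<noteq> {}"
  obtains x where "x \<in> fextreme_points K" "\<And>y. y \<in> K \<Longrightarrow> (\<Sum>a\<in>F. g a * y a) \<le> (\<Sum>a\<in>F. g a * x a)"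
proof -
  have "closed_face K K" using K unfolding closed_face_def by (simp add: compact_imp_closed)
  then have "closed_face K {x \<in> K. \<forall>y\<in>K. (\<Sum>a\<in>F. g a * y a) \<le> (\<Sum>a\<in>F. g a * x a)}"
  proof (rule closed_face_maximizers[OF K(1)])
    show "continuous_on UNIV (\<lambda>x :: 'a \<Rightarrow> real. \<Sum>a\<in>F. g a * x a)"
      by (rule continuous_on_linear)
  qed (simp add: sum_distrib_left sum.distrib[symmetric] algebra_simps)
  from closed_face_contains_extreme[OF K(1) this] show thesis using that by blast
qed

section \<open>The cone of measures and moments of Borel probabilities\<close>

text \<open>The unnormalized barycentre of the part of \<open>M\<close> on \<open>B\<close>, taken
  coordinatewise.\<close>

definition moment :: "('a \<Rightarrow> real) measure \<Rightarrow> ('a \<Rightarrow> real) set \<Rightarrow> 'a \<Rightarrow> real" where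
  "moment M B a = (LINT x:B|M. x a)"

lemma borel_measurable_coordinate:
  "(\<lambda>x :: 'a \<Rightarrow> 'b::topological_space. x a) \<in> borel_measurable borel"
  by (rule borel_measurable_continuous_onI[OF continuous_on_product_coordinates])

lemma pea_measure_add:
  "pea_measure pl p \<Longrightarrow> pea_measure pl q \<Longrightarrow> pea_measure pl (\<lambda>a. p a + q a)"
  unfolding pea_measure_def signed_measure_def by (simp add: algebra_simps)

lemma pea_measure_scale:
  "pea_measure pl p \<Longrightarrow> 0 \<le> t \<Longrightarrow> pea_measure pl (\<lambda>a. t * p a)"
  unfolding pea_measure_def signed_measure_def by (simp add: algebra_simps)

lemma pea_measure_nonneg: "pea_measure pl p \<Longrightarrow> 0 \<le> p a"
  unfolding pea_measure_def by simp

lemma pea_measure_diff_trans: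
  assumes "pea_measure pl (\<lambda>a. q a - p a)" "pea_measure pl (\<lambda>a. r a - q a)"
  shows "pea_measure pl (\<lambda>a. r a - p a)"
  using pea_measure_add[OF assms] by simp

text \<open>Complements bound a measure by its value at \<open>u\<close>; this puts the states into
  a cube and makes their space compact.\<close>

locale complemented =
  fixes pl :: "'a \<Rightarrow> 'a \<Rightarrow> 'a option" and u :: 'a
  assumes complement: "\<exists>d. pl a d = Some u"
begin

section \<open>The state space as a base of the cone of measures\<close>

abbreviation "K \<equiv> state_space pl u"
abbreviation "X \<equiv> fextreme_points K"
abbreviation "meas \<equiv> pea_measure pl"

lemma state_iff:
  "s \<in> K \<longleftrightarrow> (\<forall>a b c. pl a b = Some c \<longrightarrow> s c = s a + s b) \<and> (\<forall>a. 0 \<le> s a) \<and> s u = 1"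
  by (auto simp: state_space_def pea_state_def pea_measure_def signed_measure_def)

lemma state_meas: "s \<in> K \<Longrightarrow> meas s"
  by (simp add: state_space_def pea_state_def)

lemma state_unit: "s \<in> K \<Longrightarrow> s u = 1"
  by (simp add: state_iff)

lemma meas_le_unit:
  assumes "meas m" shows "m a \<le> m u"
proof -
  obtain d where "pl a d = Some u" using complement by blast
  then have "m u = m a + m d" using assms unfolding pea_measure_def signed_measure_def by blast
  then show ?thesis using pea_measure_nonneg[OF assms, of d] by simp
qed

lemma state_bounds: "s \<in> K \<Longrightarrow> 0 \<le> s a \<and> s a \<le> 1"
  using meas_le_unit[OF state_meas] pea_measure_nonneg[OF state_meas] state_unit by metis

lemma meas_null: "meas m \<Longrightarrow> m u \<le> 0 \<Longrightarrow> m = (\<lambda>a. 0)"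
  using meas_le_unit pea_measure_nonneg by (metis antisym order_trans)

lemma normalize: "meas m \<Longrightarrow> 0 < m u \<Longrightarrow> (\<lambda>a. m a / m u) \<in> K"
  unfolding state_iff pea_measure_def signed_measure_def by (simp add: add_divide_distrib)

lemma fconvex_K: "fconvex K"
  unfolding fconvex_def
proof (intro ballI allI impI)
  fix x y t assume x: "x \<in> K" and y: "y \<in> K" and t: "0 \<le> t \<and> (t::real) \<le> 1"
  have "(1 - t) * x c + t * y c = ((1 - t) * x a + t * y a) + ((1 - t) * x b + t * y b)"
    if "pl a b = Some c" for a b c
  proof -
    have "x c = x a + x b" "y c = y a + y b" using x y that unfolding state_iff by blast+
    then show ?thesis by (simp add: algebra_simps)
  qed
  with t show "(\<lambda>a. (1 - t) * x a + t * y a) \<in> K"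
    using state_bounds[OF x] state_bounds[OF y] state_unit[OF x] state_unit[OF y]
    unfolding state_iff by simp
qed

lemma closed_K: "closed K"
proof -
  have "closed {s :: 'a \<Rightarrow> real. pl a b = Some c \<longrightarrow> s c = s a + s b}" for a b c
    by (cases "pl a b = Some c")
       (simp_all add: closed_Collect_eq[OF continuous_on_coordinate
          continuous_on_add[OF continuous_on_coordinate continuous_on_coordinate]])
  moreover have "closed {s :: 'a \<Rightarrow> real. 0 \<le> s a}" for a
    by (rule closed_Collect_le[OF continuous_on_const continuous_on_coordinate])
  moreover have "closed {s :: 'a \<Rightarrow> real. s u = 1}"
    by (rule closed_Collect_eq[OF continuous_on_coordinate continuous_on_const])
  moreover have "K = {s. \<forall>a b c. pl a b = Some c \<longrightarrow> s c = s a + s b} \<inter> {s. \<forall>a. 0 \<le> s a} \<inter> {s. s u = 1}"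
    unfolding set_eq_iff state_iff by blast
  ultimately show ?thesis by (simp only: closed_Int closed_Collect_all)
qed

text \<open>A measure of positive total mass normalizes to a state, and one of total mass zero
  vanishes. Hence the cone order says that the difference is a measure.\<close>

lemma fcone_K:
  assumes "K \<noteq> {}"
  shows "fcone K = {m. meas m}"
proof (intro equalityI subsetI)
  fix m assume "m \<in> fcone K"
  then show "m \<in> {m. meas m}"
    by (auto simp: fcone_def intro: pea_measure_scale state_meas)
next
  fix m assume "m \<in> {m. meas m}"
  then have m: "meas m" by simp
  show "m \<in> fcone K"
  proof (cases "0 < m u")
    case True
    show ?thesis unfolding fcone_def mem_Collect_eq
    proof (rule exI[of _ "m u"], rule conjI, goal_cases)
      case 2
      show ?case by (rule bexI[of _ "\<lambda>a. m a / m u"]) (use True normalize[OF m True] in simp_all)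
    qed (use True in simp)
  next
    case False
    obtain s where s: "s \<in> K" using assms by blast
    have m0: "m = (\<lambda>a. 0)" by (rule meas_null[OF m]) (use False in simp)
    show ?thesis unfolding fcone_def mem_Collect_eq
    proof (rule exI[of _ 0], rule conjI, goal_cases)
      case 2
      show ?case by (rule bexI[OF _ s]) (simp add: m0)
    qed simp
  qed
qed

text \<open>The first summand is the meet of \<open>w\<close> and \<open>p\<close>; that \<open>w - w \<sqinter> p \<le> q\<close> is the
  translation identity \<open>(p + q) \<sqinter> (w + q) = p \<sqinter> w + q\<close>.\<close>

lemma Riesz_decomposition:
  assumes "K \<noteq> {}" "lattice_cone (fcone K)"
    and m: "meas w" "meas p" "meas q" and le: "meas (\<lambda>a. p a + q a - w a)"
  obtains v where "meas v" "meas (\<lambda>a. w a - v a)" "meas (\<lambda>a. p a - v a)" "meas (\<lambda>a. q a - (w a - v a))"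
proof -
  have glb: "\<exists>z. meas z \<and> meas (\<lambda>a. x a - z a) \<and> meas (\<lambda>a. y a - z a) \<and>
     (\<forall>w. meas w \<longrightarrow> meas (\<lambda>a. x a - w a) \<and> meas (\<lambda>a. y a - w a) \<longrightarrow> meas (\<lambda>a. z a - w a))"
    if "meas x" "meas y" for x y
    using assms(2)[unfolded lattice_cone_def fcone_K[OF assms(1)] cone_le_def Bex_def Ball_def mem_Collect_eq,
        THEN spec, THEN mp, OF that(1), THEN spec, THEN mp, OF that(2), THEN conjunct2] .
  from glb[OF m(1,2)] obtain v where v: "meas v \<and> meas (\<lambda>a. w a - v a) \<and> meas (\<lambda>a. p a - v a) \<and>
    (\<forall>y. meas y \<longrightarrow> meas (\<lambda>a. w a - y a) \<and> meas (\<lambda>a. p a - y a) \<longrightarrow> meas (\<lambda>a. v a - y a))"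
    by (rule exE)
  from glb[OF pea_measure_add[OF m(2,3)] pea_measure_add[OF m(1,3)]]
  obtain z where z: "meas z \<and> meas (\<lambda>a. p a + q a - z a) \<and> meas (\<lambda>a. w a + q a - z a) \<and>
    (\<forall>y. meas y \<longrightarrow> meas (\<lambda>a. p a + q a - y a) \<and> meas (\<lambda>a. w a + q a - y a) \<longrightarrow> meas (\<lambda>a. z a - y a))"
    by (rule exE)
  have zle: "meas (\<lambda>a. z a - y a)"
    if "meas y" "meas (\<lambda>a. p a + q a - y a)" "meas (\<lambda>a. w a + q a - y a)" for y
    using z that by simp
  \<comment> \<open>Both \<open>q\<close> and, because of \<open>le\<close>, \<open>w\<close> are
    common lower bounds of \<open>p + q\<close> and \<open>w + q\<close>, so the meet
    \<open>z\<close> dominates each of them.\<close>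
  have "meas (\<lambda>a. z a - q a)" by (rule zle) (use m in simp_all)
  moreover have "(\<lambda>a. w a - (z a - q a)) = (\<lambda>a. w a + q a - z a)"
    "(\<lambda>a. p a - (z a - q a)) = (\<lambda>a. p a + q a - z a)" by (simp_all add: fun_eq_iff)
  ultimately have "meas (\<lambda>a. v a - (z a - q a))"
    using v[THEN conjunct2, THEN conjunct2, THEN conjunct2, THEN spec[of _ "\<lambda>a. z a - q a"]] z by simp
  moreover have "meas (\<lambda>a. z a - w a)" by (rule zle) (use m le in simp_all)
  \<comment> \<open>Adding \<open>z - q \<le> v\<close> and \<open>w \<le> z\<close> cancels
    \<open>z\<close> and leaves \<open>w - v \<le> q\<close>.\<close>
  ultimately have "meas (\<lambda>a. (v a - (z a - q a)) + (z a - w a))" by (rule pea_measure_add)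
  moreover have "(\<lambda>a. (v a - (z a - q a)) + (z a - w a)) = (\<lambda>a. q a - (w a - v a))" by (simp add: fun_eq_iff)
  ultimately have "meas (\<lambda>a. q a - (w a - v a))" by simp
  with v show thesis by (intro that[of v]) simp_all
qed

section \<open>Moments as measures on the algebra\<close>

lemma set_integrable_coordinate:
  assumes M: "prob_space M" "sets M = sets borel" and B: "B \<in> sets borel" "B \<subseteq> K"
  shows "set_integrable M B (\<lambda>x. x a)"
proof -
  interpret prob_space M by fact
  have "(\<lambda>x. indicator B x *\<^sub>R x a) \<in> borel_measurable borel"
    using B(1) by (rule borel_measurable_scaleR[OF borel_measurable_indicator borel_measurable_coordinate])
  then have "(\<lambda>x. indicator B x *\<^sub>R x a) \<in> borel_measurable M"
    using measurable_cong_sets[OF M(2) refl] by blast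
  moreover have "norm (indicator B x *\<^sub>R x a) \<le> 1" for x
    using state_bounds[of x a] B by (auto simp: indicator_def)
  ultimately show ?thesis
    unfolding set_integrable_def by (intro integrable_const_bound[where B=1]) auto
qed

lemma moment_unit:
  assumes M: "prob_space M" "sets M = sets borel" and B: "B \<in> sets borel" "B \<subseteq> K"
  shows "moment M B u = measure M B"
proof -
  interpret prob_space M by fact
  have "moment M B u = (LINT x:B|M. 1)"
    unfolding moment_def using M B state_unit by (intro set_lebesgue_integral_cong) auto
  also have "\<dots> = measure M B" using M B by (simp add: set_lebesgue_integral_def)
  finally show ?thesis .
qed

lemma moment_linear:
  assumes M: "prob_space M" "sets M = sets borel" and B: "B \<in> sets borel" "B \<subseteq> K"
    and le: "\<And>x. x \<in> B \<Longrightarrow> (\<Sum>a\<in>F. g a * x a) \<le> c"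
  shows "(\<Sum>a\<in>F. g a * moment M B a) \<le> c * measure M B"
proof -
  interpret prob_space M by fact
  have int: "set_integrable M B (\<lambda>x. g a * x a)" for a
    using set_integrable_coordinate[OF M B] by (intro set_integrable_mult_right)
  have "(\<Sum>a\<in>F. g a * moment M B a) = (\<Sum>a\<in>F. LINT x:B|M. g a * x a)"
    unfolding moment_def by simp
  also have "\<dots> = (\<Sum>a\<in>F. LINT x|M. indicator B x *\<^sub>R (g a * x a))"
    unfolding set_lebesgue_integral_def by simp
  also have "\<dots> = (LINT x|M. (\<Sum>a\<in>F. indicator B x *\<^sub>R (g a * x a)))"
    using int unfolding set_integrable_def by (intro Bochner_Integration.integral_sum[symmetric])
  also have "\<dots> \<le> (LINT x|M. c * indicator B x)"
  proof (rule integral_mono)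
    show "integrable M (\<lambda>x. \<Sum>a\<in>F. indicator B x *\<^sub>R (g a * x a))"
      using int unfolding set_integrable_def by (intro Bochner_Integration.integrable_sum)
    show "integrable M (\<lambda>x. c * indicator B x)"
      using M B by (intro integrable_mult_right integrable_real_indicator) (auto simp: emeasure_eq_measure)
    show "(\<Sum>a\<in>F. indicator B x *\<^sub>R (g a * x a)) \<le> c * indicator B x" for x
      using le[of x] by (cases "x \<in> B") auto
  qed
  also have "\<dots> = c * measure M B" using M B by simp
  finally show ?thesis .
qed

lemma moment_upper:
  assumes M: "prob_space M" "sets M = sets borel" and B: "B \<in> sets borel" "B \<subseteq> K"
    and le: "\<And>x. x \<in> B \<Longrightarrow> x a \<le> c"
  shows "moment M B a \<le> c * measure M B"
  using moment_linear[OF M B, where F="{a}" and g="\<lambda>_. 1" and c=c] le by simp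

lemma moment_lower:
  assumes M: "prob_space M" "sets M = sets borel" and B: "B \<in> sets borel" "B \<subseteq> K"
    and le: "\<And>x. x \<in> B \<Longrightarrow> c \<le> x a"
  shows "c * measure M B \<le> moment M B a"
  using moment_linear[OF M B, where F="{a}" and g="\<lambda>_. - 1" and c="- c"] le by simp

lemma moment_meas:
  assumes M: "prob_space M" "sets M = sets borel" and B: "B \<in> sets borel" "B \<subseteq> K"
  shows "meas (moment M B)"
  unfolding pea_measure_def signed_measure_def
proof (intro conjI allI impI)
  fix a b c assume abc: "pl a b = Some c"
  have "moment M B c = (LINT x:B|M. x a + x b)"
    unfolding moment_def using M B abc by (intro set_lebesgue_integral_cong) (auto simp: state_iff)
  also have "\<dots> = moment M B a + moment M B b"
    unfolding moment_def using set_integrable_coordinate[OF M B] by (intro set_integral_add)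
  finally show "moment M B c = moment M B a + moment M B b" .
next
  fix a show "0 \<le> moment M B a" using moment_lower[OF M B, of 0 a] B state_bounds by auto
qed

lemma moment_Un:
  assumes M: "prob_space M" "sets M = sets borel"
    and A: "A \<in> sets borel" "A \<subseteq> K" and B: "B \<in> sets borel" "B \<subseteq> K" and "A \<inter> B = {}"
  shows "moment M (A \<union> B) a = moment M A a + moment M B a"
  unfolding moment_def
  using assms by (intro set_integral_Un set_integrable_coordinate[OF M]) auto

lemma moment_mono:
  assumes M: "prob_space M" "sets M = sets borel"
    and A: "A \<in> sets borel" and B: "B \<in> sets borel" "B \<subseteq> K" and "A \<subseteq> B"
  shows "meas (\<lambda>a. moment M B a - moment M A a)"
proof -
  have "moment M B a = moment M A a + moment M (B - A) a" for a
    using moment_Un[OF M, of A "B - A" a] assms by (auto simp: Un_absorb1)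
  then show ?thesis using moment_meas[OF M, of "B - A"] A B by (auto simp: fun_eq_iff)
qed

end

section \<open>Barycentres\<close>

text \<open>The sum is the floor of \<open>y\<close>, since \<open>y \<le> n\<close> lets every
  level be counted. Such layer counts integrate a coordinate through the values of a content on
  level sets alone.\<close>

lemma sum_levels:
  fixes y :: real
  assumes "0 \<le> y" "y \<le> real n"
  shows "(\<Sum>k=1..n. of_bool (real k \<le> y)) \<le> y" "y \<le> 1 + (\<Sum>k=1..n. of_bool (real k \<le> y))"
proof -
  have "{1..n} \<inter> {k. real k \<le> y} = {1..nat \<lfloor>y\<rfloor>}"
    using assms by (auto simp: le_nat_floor of_nat_floor nat_le_iff) linarith+
  then have "(\<Sum>k=1..n. of_bool (real k \<le> y) :: real) = of_int \<lfloor>y\<rfloor>"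
    using assms by (simp add: sum_of_bool_eq)
  then show "(\<Sum>k=1..n. of_bool (real k \<le> y)) \<le> y" "y \<le> 1 + (\<Sum>k=1..n. of_bool (real k \<le> y))"
    by linarith+
qed

lemma compact_content_Dirac:
  fixes C :: "'b::t2_space set"
  assumes "compact C" "x \<in> C"
  shows "compact_content (\<lambda>A. of_bool (x \<in> A)) C"
  using assms by unfold_locales auto

lemma compact_content_convex:
  fixes C :: "'b::t2_space set"
  assumes "compact_content \<mu> C" "compact_content \<nu> C" "0 \<le> t" "t \<le> 1"
  shows "compact_content (\<lambda>A. (1 - t) * \<mu> A + t * \<nu> A) C"
proof -
  interpret m: compact_content \<mu> C by fact
  interpret n: compact_content \<nu> C by fact
  show ?thesis
  proof
    show "0 \<le> (1 - t) * \<mu> A + t * \<nu> A" for A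
      using assms(3,4) m.nonneg n.nonneg by simp
    show "(1 - t) * \<mu> (A \<union> B) + t * \<nu> (A \<union> B) = (1 - t) * \<mu> A + t * \<nu> A + ((1 - t) * \<mu> B + t * \<nu> B)"
      if "A \<inter> B = {}" for A B
      using m.Un_disjoint[OF that] n.Un_disjoint[OF that] by (simp add: algebra_simps)
  qed (simp_all add: m.compl_null n.compl_null m.total n.total m.compact)
qed

lemma (in compact_content) le_one: "\<nu> A \<le> 1"
  using mono[of "A \<inter> C" C] by (simp add: Int_support total)

context complemented
begin

lemma compact_K: "compact K"
proof -
  have "K = {f. \<forall>a. f a \<in> {0..1}} \<inter> K" using state_bounds by auto
  also have "compact \<dots>" by (intro compact_Int_closed closed_K compact_Pi_UNIV) simp
  finally show ?thesis .
qed

text \<open>Barycentres of the finitely additive probabilities on \<open>C\<close>: the sum is a lower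
  Riemann-Lebesgue sum for the integral of the coordinate \<open>a\<close>. Only one inequality is imposed
  since the other one follows by passing to the complement of \<open>a\<close>.\<close>

definition barycentres :: "('a \<Rightarrow> real) set \<Rightarrow> ('a \<Rightarrow> real) set" where
  "barycentres C = {s \<in> K. \<exists>\<nu>. compact_content \<nu> C \<and>
     (\<forall>a n. real n * s a \<le> 1 + (\<Sum>k=1..n. \<nu> {x. real k \<le> real n * x a}))}"

lemma subset_barycentres:
  assumes "compact C" "C \<subseteq> K"
  shows "C \<subseteq> barycentres C"
proof
  fix s assume s: "s \<in> C"
  then have sK: "s \<in> K" using assms by auto
  have "real n * s a \<le> 1 + (\<Sum>k=1..n. of_bool (s \<in> {x. real k \<le> real n * x a}))" for a n
    using sum_levels(2)[of "real n * s a" n] state_bounds[OF sK, of a]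
    by (simp add: mult_left_le)
  then show "s \<in> barycentres C"
    unfolding barycentres_def using sK compact_content_Dirac[OF assms(1) s] by blast
qed

text \<open>The defining inequality is affine jointly in the state and the content.\<close>

lemma fconvex_barycentres: "fconvex (barycentres C)"
  unfolding fconvex_def
proof (intro ballI allI impI)
  fix x y t assume xy: "x \<in> barycentres C" "y \<in> barycentres C" and t: "0 \<le> t \<and> (t::real) \<le> 1"
  obtain \<mu> where m: "x \<in> K" "compact_content \<mu> C"
    "\<forall>a n. real n * x a \<le> 1 + (\<Sum>k=1..n. \<mu> {x. real k \<le> real n * x a})"
    using xy(1) unfolding barycentres_def mem_Collect_eq by (elim conjE exE)
  obtain \<nu> where n: "y \<in> K" "compact_content \<nu> C"
    "\<forall>a n. real n * y a \<le> 1 + (\<Sum>k=1..n. \<nu> {x. real k \<le> real n * x a})"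
    using xy(2) unfolding barycentres_def mem_Collect_eq by (elim conjE exE)
  let ?l = "\<lambda>A. (1 - t) * \<mu> A + t * \<nu> A"
  have "real n * ((1 - t) * x a + t * y a) \<le> 1 + (\<Sum>k=1..n. ?l {x. real k \<le> real n * x a})" for a n
  proof -
    have "real n * ((1 - t) * x a + t * y a) = (1 - t) * (real n * x a) + t * (real n * y a)"
      by (simp add: algebra_simps)
    also have "\<dots> \<le> (1 - t) * (1 + (\<Sum>k=1..n. \<mu> {x. real k \<le> real n * x a}))
        + t * (1 + (\<Sum>k=1..n. \<nu> {x. real k \<le> real n * x a}))"
      using m(3) n(3) t by (intro add_mono mult_left_mono) auto
    also have "\<dots> = 1 + (\<Sum>k=1..n. ?l {x. real k \<le> real n * x a})"
      unfolding sum.distrib sum_distrib_left[symmetric] by (simp add: algebra_simps)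
    finally show ?thesis .
  qed
  moreover have "compact_content ?l C" using m n t by (intro compact_content_convex) auto
  moreover have "(\<lambda>a. (1 - t) * x a + t * y a) \<in> K"
    using fconvexD[OF fconvex_K m(1) n(1)] t by simp
  ultimately show "(\<lambda>a. (1 - t) * x a + t * y a) \<in> barycentres C"
    unfolding barycentres_def mem_Collect_eq by (intro conjI exI[of _ ?l]) auto
qed

text \<open>The set is the projection of a set of pairs of a state and a content. Each instance of
  the conditions is closed because it involves finitely many coordinates, and the pairs lie in a
  product that is compact by Tychonoff's theorem.\<close>

lemma compact_barycentres:
  assumes C: "compact C"
  shows "compact (barycentres C)"
proof -
  define Q :: "(('a \<Rightarrow> real) \<times> (('a \<Rightarrow> real) set \<Rightarrow> real)) set" where
    "Q = {p. \<forall>A. 0 \<le> snd p A} \<inter> {p. \<forall>A B. A \<inter> B = {} \<longrightarrow> snd p (A \<union> B) = snd p A + snd p B}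
       \<inter> {p. snd p (- C) = 0} \<inter> {p. snd p C = 1}
       \<inter> {p. \<forall>a n. real n * fst p a \<le> 1 + (\<Sum>k=1..n. snd p {x. real k \<le> real n * x a})}"
  define R where "R = K \<times> {f :: ('a \<Rightarrow> real) set \<Rightarrow> real. \<forall>A. f A \<in> {0..1}}"
  have cf: "continuous_on UNIV (\<lambda>p :: ('a \<Rightarrow> real) \<times> (('a \<Rightarrow> real) set \<Rightarrow> real). fst p a)" for a
    by (rule continuous_on_product_then_coordinatewise[OF continuous_on_fst[OF continuous_on_id]])
  have cs: "continuous_on UNIV (\<lambda>p :: ('a \<Rightarrow> real) \<times> (('a \<Rightarrow> real) set \<Rightarrow> real). snd p A)" for A
    by (rule continuous_on_product_then_coordinatewise[OF continuous_on_snd[OF continuous_on_id]])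
  have "closed {p :: ('a \<Rightarrow> real) \<times> (('a \<Rightarrow> real) set \<Rightarrow> real). A \<inter> B = {} \<longrightarrow> snd p (A \<union> B) = snd p A + snd p B}"
    for A B
    by (cases "A \<inter> B = {}") (simp_all add: closed_Collect_eq[OF cs continuous_on_add[OF cs cs]])
  then have 1: "closed {p :: ('a \<Rightarrow> real) \<times> (('a \<Rightarrow> real) set \<Rightarrow> real). \<forall>A B. A \<inter> B = {} \<longrightarrow> snd p (A \<union> B) = snd p A + snd p B}"
    by (intro closed_Collect_all)
  have 2: "closed {p :: ('a \<Rightarrow> real) \<times> (('a \<Rightarrow> real) set \<Rightarrow> real). \<forall>A. 0 \<le> snd p A}"
    by (rule closed_Collect_all, rule closed_Collect_le[OF continuous_on_const cs])
  have 3: "closed {p :: ('a \<Rightarrow> real) \<times> (('a \<Rightarrow> real) set \<Rightarrow> real). snd p A = r}" for A r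
    by (rule closed_Collect_eq[OF cs continuous_on_const])
  have 4: "closed {p :: ('a \<Rightarrow> real) \<times> (('a \<Rightarrow> real) set \<Rightarrow> real).
      \<forall>a n. real n * fst p a \<le> 1 + (\<Sum>k=1..n. snd p {x. real k \<le> real n * x a})}"
    by (rule closed_Collect_all, rule closed_Collect_all,
        rule closed_Collect_le[OF continuous_on_mult[OF continuous_on_const cf]
          continuous_on_add[OF continuous_on_const continuous_on_sum[OF cs]]])
  have "closed Q" unfolding Q_def by (rule closed_Int closed_Int 1 2 3 4)+
  moreover have "compact R" unfolding R_def by (intro compact_Times compact_K compact_Pi_UNIV) simp
  ultimately have "compact (R \<inter> Q)" by (simp add: compact_Int_closed)
  then have "compact (fst ` (R \<inter> Q))"
    by (rule compact_continuous_image[rotated]) (rule continuous_on_fst[OF continuous_on_id])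
  also have "fst ` (R \<inter> Q) = barycentres C"
  proof (intro equalityI subsetI)
    fix s assume "s \<in> fst ` (R \<inter> Q)"
    then obtain \<nu> where p: "(s, \<nu>) \<in> R" "(s, \<nu>) \<in> Q" by auto
    from p(2) C have "compact_content \<nu> C" unfolding Q_def by unfold_locales simp_all
    moreover have "\<forall>a n. real n * s a \<le> 1 + (\<Sum>k=1..n. \<nu> {x. real k \<le> real n * x a})"
      using p(2) unfolding Q_def by simp
    moreover have "s \<in> K" using p(1) unfolding R_def by simp
    ultimately show "s \<in> barycentres C" unfolding barycentres_def by blast
  next
    fix s assume "s \<in> barycentres C"
    then obtain \<nu> where s: "s \<in> K" and c: "compact_content \<nu> C"
      and l: "\<forall>a n. real n * s a \<le> 1 + (\<Sum>k=1..n. \<nu> {x. real k \<le> real n * x a})"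
      unfolding barycentres_def mem_Collect_eq by (elim conjE exE)
    interpret compact_content \<nu> C by fact
    have "(s, \<nu>) \<in> R" unfolding R_def using s nonneg le_one by simp
    moreover have "(s, \<nu>) \<in> Q" unfolding Q_def using nonneg Un_disjoint compl_null total l by simp
    ultimately show "s \<in> fst ` (R \<inter> Q)" by force
  qed
  finally show ?thesis .
qed

text \<open>The measure is the Borel extension of the content. By \<open>closed_le\<close> the level
  sets do not lose mass, so the lower sums give \<open>n * s a \<le> 1 + n * moment M C a\<close>
  for all \<open>n\<close>, and the constant disappears in the limit.\<close>

lemma barycentre_representation:
  assumes C: "compact C" "C \<subseteq> K" and s: "s \<in> barycentres C"
  obtains M where "prob_space M" "sets M = sets borel" "measure M C = 1" "s = moment M C"
    "\<And>A e. A \<in> sets borel \<Longrightarrow> 0 < e \<Longrightarrow> \<exists>U. open U \<and> A \<subseteq> U \<and> measure M U < measure M A + e"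
    "\<And>A e. A \<in> sets borel \<Longrightarrow> 0 < e \<Longrightarrow> \<exists>D. compact D \<and> D \<subseteq> A \<inter> C \<and> measure M A < measure M D + e"
proof -
  obtain \<nu> where sK: "s \<in> K" and c: "compact_content \<nu> C"
    and l: "\<forall>a n. real n * s a \<le> 1 + (\<Sum>k=1..n. \<nu> {x. real k \<le> real n * x a})"
    using s unfolding barycentres_def mem_Collect_eq by (elim conjE exE)
  interpret compact_content \<nu> C by fact
  note M = prob_space_borel_extension sets_borel_extension
  let ?M = "borel_extension"
  have Cb: "C \<in> sets borel" by (rule borel_closed[OF compact_imp_closed[OF C(1)]])
  have le: "s a \<le> moment ?M C a" for a
  proof -
    have "real n * s a \<le> 1 + real n * moment ?M C a" for n
    proof -
      define L where "L k = {x :: 'a \<Rightarrow> real. real k \<le> real n * x a}" for k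
      have Lc: "closed (L k)" for k
        unfolding L_def
        by (rule closed_Collect_le[OF continuous_on_const continuous_on_mult[OF continuous_on_const continuous_on_coordinate]])
      have Lb: "C \<inter> L k \<in> sets ?M" for k using Lc Cb by (simp add: sets_borel_extension)
      have "(\<Sum>k=1..n. \<nu> (L k)) \<le> (\<Sum>k=1..n. measure ?M (C \<inter> L k))"
      proof (rule sum_mono)
        fix k
        have "closed (C \<inter> L k)" using Lc C compact_imp_closed by (intro closed_Int)
        from closed_le[OF this] show "\<nu> (L k) \<le> measure ?M (C \<inter> L k)"
          using Int_support[of "L k"] by (simp add: Int_commute)
      qed
      also have "\<dots> = (\<Sum>k=1..n. LINT x|?M. indicator (C \<inter> L k) x)"
        using Lb by simp
      also have "\<dots> = (LINT x|?M. (\<Sum>k=1..n. indicator (C \<inter> L k) x))"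
        using Lb by (intro Bochner_Integration.integral_sum[symmetric] integrable_real_indicator)
          (auto simp: P.emeasure_eq_measure)
      also have "\<dots> \<le> (LINT x|?M. real n * (indicator C x *\<^sub>R x a))"
      proof (rule integral_mono)
        show "integrable ?M (\<lambda>x. \<Sum>k=1..n. indicator (C \<inter> L k) x :: real)"
          using Lb by (intro Bochner_Integration.integrable_sum integrable_real_indicator)
            (auto simp: P.emeasure_eq_measure)
        show "integrable ?M (\<lambda>x. real n * (indicator C x *\<^sub>R x a))"
          using set_integrable_coordinate[OF M Cb C(2)] unfolding set_integrable_def
          by (rule integrable_mult_right)
        fix x
        show "(\<Sum>k=1..n. indicator (C \<inter> L k) x) \<le> real n * (indicator C x *\<^sub>R x a)"
        proof (cases "x \<in> C")
          case True
          then have b: "0 \<le> x a \<and> x a \<le> 1" using C(2) state_bounds by blast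
          have "(\<Sum>k=1..n. indicator (C \<inter> L k) x :: real) = (\<Sum>k=1..n. of_bool (real k \<le> real n * x a))"
            using True unfolding L_def by (intro sum.cong) (simp_all add: indicator_def)
          also have "\<dots> \<le> real n * x a"
            using b by (intro sum_levels(1)) (simp_all add: mult_left_le)
          finally show ?thesis using True by simp
        qed simp
      qed
      also have "\<dots> = real n * moment ?M C a"
        by (simp add: moment_def set_lebesgue_integral_def)
      finally have "(\<Sum>k=1..n. \<nu> (L k)) \<le> real n * moment ?M C a" .
      with l show ?thesis unfolding L_def by (meson add_left_mono order_trans)
    qed
    then have *: "real n * (s a - moment ?M C a) \<le> 1" for n by (simp add: algebra_simps)
    show ?thesis
    proof (rule ccontr)
      assume "\<not> ?thesis"
      then obtain n where "1 < real n * (s a - moment ?M C a)"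
        using reals_Archimedean3[of "s a - moment ?M C a"] by auto
      with * show False by (simp add: not_less[symmetric])
    qed
  qed
  have "s a = moment ?M C a" for a
  proof -
    \<comment> \<open>On both sides the values at \<open>a\<close> and at its complement
      \<open>d\<close> add up to 1, so the two inequalities are equalities.\<close>
    obtain d where d: "pl a d = Some u" using complement by blast
    have add: "p u = p a + p d" if "meas p" for p
      using that d unfolding pea_measure_def signed_measure_def by simp
    have "s a + s d = moment ?M C a + moment ?M C d"
      using add[OF state_meas[OF sK]] add[OF moment_meas[OF M Cb C(2)]]
        moment_unit[OF M Cb C(2)] measure_support state_unit[OF sK] by simp
    then show ?thesis using le[of a] le[of d] by simp
  qed
  then have eq: "s = moment ?M C" by (rule ext)
  show thesis
    by (rule that[OF M measure_support eq]) (rule outer_regular inner_regular; assumption)+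
qed

end

section \<open>Extreme points and representing measures on compact sets\<close>

lemma cover_null:
  fixes C :: "'b::t2_space set"
  assumes M: "sets M = sets borel" and C: "compact C"
    and null: "\<And>x. x \<in> C \<Longrightarrow> \<exists>V. open V \<and> x \<in> V \<and> emeasure M (V \<inter> C) = 0"
  shows "emeasure M C = 0"
proof -
  obtain V where V: "\<And>x. x \<in> C \<Longrightarrow> open (V x) \<and> x \<in> V x \<and> emeasure M (V x \<inter> C) = 0"
    using null by metis
  obtain I where I: "I \<subseteq> C" "finite I" "C \<subseteq> (\<Union>x\<in>I. V x)"
    by (rule compactE_image[OF C, of C V]) (use V in auto)
  have "V x \<inter> C \<in> null_sets M" if "x \<in> I" for x
  proof -
    have "V x \<inter> C \<in> sets M"
      unfolding M using V[of x] that I(1) borel_closed[OF compact_imp_closed[OF C]] by (intro sets.Int) auto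
    then show ?thesis using V[of x] that I(1) by auto
  qed
  then have "(\<Union>x\<in>I. V x \<inter> C) \<in> null_sets M" by (rule null_sets.finite_UN[OF I(2)])
  moreover have "(\<Union>x\<in>I. V x \<inter> C) = C" using I(3) by blast
  ultimately show ?thesis by auto
qed

lemma borel_compact: "compact C \<Longrightarrow> (C :: 'b::t2_space set) \<in> sets borel"
  by (rule borel_closed[OF compact_imp_closed])

context complemented
begin

lemma extreme_subset: "X \<subseteq> K"
  unfolding fextreme_points_def by (rule Collect_restrict)

lemma extremeD:
  assumes "x \<in> X" "y \<in> K" "z \<in> K" "0 < t" "t < 1" "\<And>a. x a = t * y a + (1 - t) * z a"
  shows "y = x"
proof -
  have "x = (\<lambda>a. t * y a + (1 - t) * z a)" using assms(6) by (rule ext)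
  with assms(1-5) show ?thesis unfolding fextreme_points_def mem_Collect_eq by simp
qed

text \<open>The state \<open>x\<close> is a convex combination of the normalized \<open>w\<close>
  and the normalized \<open>x - w\<close>, with weights \<open>w u\<close> and
  \<open>1 - w u\<close>, so extremality identifies the first with \<open>x\<close>. A weight zero
  forbids normalizing, but then \<open>w\<close> or \<open>x - w\<close> is zero.\<close>

lemma meas_le_extreme:
  assumes x: "x \<in> X" and w: "meas w" "meas (\<lambda>a. x a - w a)"
  shows "w a = w u * x a"
proof -
  have xK: "x \<in> K" using x extreme_subset by blast
  have le: "w u \<le> 1" using pea_measure_nonneg[OF w(2), of u] state_unit[OF xK] by simp
  consider "w u \<le> 0" | "w u = 1" | "0 < w u" "w u < 1" using le by linarith
  then show ?thesis
  proof cases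
    case 1
    have "w = (\<lambda>a. 0)" by (rule meas_null[OF w(1) 1])
    then show ?thesis by simp
  next
    case 2
    have "(\<lambda>a. x a - w a) = (\<lambda>a. 0)" by (rule meas_null[OF w(2)]) (simp add: 2 state_unit[OF xK])
    then have "x a - w a = 0" by (rule fun_cong)
    then show ?thesis using 2 by simp
  next
    case 3
    have "(\<lambda>a. w a / w u) = x"
    proof (rule extremeD[OF x normalize[OF w(1) 3(1)] normalize[OF w(2)] 3])
      show "0 < x u - w u" using 3 state_unit[OF xK] by simp
      show "x a = w u * (w a / w u) + (1 - w u) * ((x a - w a) / (x u - w u))" for a
        using 3 state_unit[OF xK] by simp
    qed
    then have "w a / w u = x a" by (rule fun_cong)
    then show ?thesis using 3 by (simp add: field_simps)
  qed
qed

text \<open>Krein-Milman in integral form: a functional separating a state from the barycentres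
  would contradict Bauer's maximum principle.\<close>

lemma barycentres_extreme:
  assumes "K \<noteq> {}" "compact X"
  shows "barycentres X = K"
proof (rule ccontr)
  have "barycentres X \<subseteq> K" unfolding barycentres_def by (rule Collect_restrict)
  moreover assume "barycentres X \<noteq> K"
  ultimately obtain s where s: "s \<in> K" "s \<notin> barycentres X" by blast
  obtain F g c where sep: "\<And>y. y \<in> barycentres X \<Longrightarrow> (\<Sum>a\<in>F. g a * y a) \<le> c" "c < (\<Sum>a\<in>F. g a * s a)"
    using separation_compact_convex[OF compact_barycentres[OF assms(2)] fconvex_barycentres s(2)] by metis
  obtain x where x: "x \<in> X" "\<And>y. y \<in> K \<Longrightarrow> (\<Sum>a\<in>F. g a * y a) \<le> (\<Sum>a\<in>F. g a * x a)"
    using extreme_point_maximizer[OF compact_K assms(1), of g F] by metis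
  have "x \<in> barycentres X" using subset_barycentres[OF assms(2) extreme_subset] x(1) by blast
  then show False using sep(1)[of x] sep(2) x(2)[OF s(1)] by linarith
qed

text \<open>The part on \<open>B\<close> is dominated by the extreme point \<open>x\<close>, hence a
  multiple of it, and its mass is the factor.\<close>

lemma moment_extreme:
  assumes M: "prob_space M" "sets M = sets borel" and C: "C \<in> sets borel" "C \<subseteq> K" "measure M C = 1"
    and x: "x \<in> X" "x = moment M C" and B: "B \<in> sets borel" "B \<subseteq> C"
  shows "moment M B a = measure M B * x a"
proof -
  have BK: "B \<subseteq> K" using B(2) C(2) by blast
  have "meas (\<lambda>a. x a - moment M B a)"
    unfolding x(2) by (rule moment_mono[OF M B(1) C(1,2) B(2)])
  from meas_le_extreme[OF x(1) moment_meas[OF M B(1) BK] this] show ?thesis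
    by (simp add: moment_unit[OF M B(1) BK])
qed

text \<open>Milman's converse. Every part of a measure representing \<open>x\<close> has its moment
  proportional to \<open>x\<close>; on a small neighbourhood of \<open>y \<noteq> x\<close> some
  coordinate stays on one side of its value at \<open>x\<close>, so that part has mass zero.
  Compactness makes all of \<open>C\<close> null.\<close>

lemma extreme_not_barycentre:
  assumes C: "compact C" "C \<subseteq> K" and x: "x \<in> X" "x \<notin> C"
  shows "x \<notin> barycentres C"
proof
  assume "x \<in> barycentres C"
  then obtain M where M: "prob_space M" "sets M = sets borel" "measure M C = 1" "x = moment M C"
    by (rule barycentre_representation[OF C])
  interpret prob_space M by fact
  have Cb: "C \<in> sets borel" by (rule borel_compact[OF C(1)])
  have "emeasure M C = 0"
  proof (rule cover_null[OF M(2) C(1)])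
    fix y assume y: "y \<in> C"
    have moment: "moment M B a = measure M B * x a" if "B \<in> sets borel" "B \<subseteq> C" for B a
      by (rule moment_extreme[OF M(1,2) Cb C(2) M(3) x(1) M(4) that])
    have "y \<noteq> x" using x y by blast
    then obtain a where a: "y a \<noteq> x a" by (rule contrapos_np) (rule ext, blast)
    \<comment> \<open>The midpoint separates the coordinate values strictly, leaving a positive
      factor in front of the mass.\<close>
    define r where "r = (x a + y a) / 2"
    have op: "open {p :: 'a \<Rightarrow> real. r < p a}" "open {p :: 'a \<Rightarrow> real. p a < r}"
      by (rule open_Collect_less[OF continuous_on_const continuous_on_coordinate],
          rule open_Collect_less[OF continuous_on_coordinate continuous_on_const])
    show "\<exists>V. open V \<and> y \<in> V \<and> emeasure M (V \<inter> C) = 0"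
    proof (cases "x a < y a")
      case True
      let ?B = "{p. r < p a} \<inter> C"
      have B: "?B \<in> sets borel" using op Cb by (intro sets.Int) simp_all
      have "r * measure M ?B \<le> moment M ?B a"
        using C(2) by (intro moment_lower[OF M(1,2) B]) auto
      then have "(r - x a) * measure M ?B \<le> 0" by (simp add: moment[OF B] algebra_simps)
      moreover have "0 < r - x a" using True by (simp add: r_def)
      ultimately have "measure M ?B = 0" by (simp add: mult_le_0_iff measure_le_0_iff)
      then show ?thesis
        using op True by (intro exI[of _ "{p. r < p a}"]) (simp add: r_def emeasure_eq_measure)
    next
      case False
      let ?B = "{p. p a < r} \<inter> C"
      have B: "?B \<in> sets borel" using op Cb by (intro sets.Int) simp_all
      have "moment M ?B a \<le> r * measure M ?B"
        using C(2) by (intro moment_upper[OF M(1,2) B]) auto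
      then have "(x a - r) * measure M ?B \<le> 0" by (simp add: moment[OF B] algebra_simps)
      moreover have "0 < x a - r" using False a by (simp add: r_def)
      ultimately have "measure M ?B = 0" by (simp add: mult_le_0_iff measure_le_0_iff)
      then show ?thesis
        using op False a by (intro exI[of _ "{p. p a < r}"]) (simp add: r_def emeasure_eq_measure)
    qed
  qed
  with M(3) show False by (simp add: emeasure_eq_measure)
qed

end

section \<open>Measures below the barycentre of a part of the boundary\<close>

lemma real_open_cball:
  assumes "open (S :: real set)" "x \<in> S"
  obtains e where "0 < e" "\<And>y. \<bar>y - x\<bar> \<le> e \<Longrightarrow> y \<in> S"
proof -
  obtain e where "0 < e" "cball x e \<subseteq> S" using assms open_contains_cball by blast
  then show thesis using that[of e] by (auto simp: dist_real_def subset_iff abs_minus_commute)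
qed

context complemented
begin

text \<open>The pairs \<open>w \<le> y\<close> that violate the bound form a compact set; its projection misses \<open>x\<close> because
  an extreme point only dominates multiples of itself.\<close>

lemma dominated_near_extreme:
  fixes g :: "'a \<Rightarrow> real"
  assumes x: "x \<in> X" and le: "(\<Sum>a\<in>F. g a * x a) \<le> c" and e: "0 < e"
  shows "\<exists>V. open V \<and> x \<in> V \<and> (\<forall>y w. y \<in> V \<longrightarrow> y \<in> K \<longrightarrow> meas w \<longrightarrow> meas (\<lambda>a. y a - w a) \<longrightarrow>
    (\<Sum>a\<in>F. g a * w a) - c * w u < e)"
proof -
  \<comment> \<open>Pointwise \<open>w \<le> y\<close> expresses domination, since the difference of
    additive functions is additive. It also gives \<open>w \<le> 1\<close>, which confines the pairs
    to the compact set \<open>R\<close>.\<close>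
  define S :: "(('a \<Rightarrow> real) \<times> ('a \<Rightarrow> real)) set" where
    "S = {p. \<forall>a. 0 \<le> snd p a} \<inter> {p. \<forall>a b d. pl a b = Some d \<longrightarrow> snd p d = snd p a + snd p b}
       \<inter> {p. \<forall>a. snd p a \<le> fst p a} \<inter> {p. e \<le> (\<Sum>a\<in>F. g a * snd p a) - c * snd p u}"
  define R where "R = K \<times> {f :: 'a \<Rightarrow> real. \<forall>a. f a \<in> {0..1}}"
  have cf: "continuous_on UNIV (\<lambda>p :: ('a \<Rightarrow> real) \<times> ('a \<Rightarrow> real). fst p a)" for a
    by (rule continuous_on_product_then_coordinatewise[OF continuous_on_fst[OF continuous_on_id]])
  have cs: "continuous_on UNIV (\<lambda>p :: ('a \<Rightarrow> real) \<times> ('a \<Rightarrow> real). snd p a)" for a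
    by (rule continuous_on_product_then_coordinatewise[OF continuous_on_snd[OF continuous_on_id]])
  have "closed {p :: ('a \<Rightarrow> real) \<times> ('a \<Rightarrow> real). pl a b = Some d \<longrightarrow> snd p d = snd p a + snd p b}" for a b d
    by (cases "pl a b = Some d") (simp_all add: closed_Collect_eq[OF cs continuous_on_add[OF cs cs]])
  then have 1: "closed {p :: ('a \<Rightarrow> real) \<times> ('a \<Rightarrow> real). \<forall>a b d. pl a b = Some d \<longrightarrow> snd p d = snd p a + snd p b}"
    by (intro closed_Collect_all)
  have 2: "closed {p :: ('a \<Rightarrow> real) \<times> ('a \<Rightarrow> real). \<forall>a. 0 \<le> snd p a}"
    by (rule closed_Collect_all, rule closed_Collect_le[OF continuous_on_const cs])
  have 3: "closed {p :: ('a \<Rightarrow> real) \<times> ('a \<Rightarrow> real). \<forall>a. snd p a \<le> fst p a}"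
    by (rule closed_Collect_all, rule closed_Collect_le[OF cs cf])
  have 4: "closed {p :: ('a \<Rightarrow> real) \<times> ('a \<Rightarrow> real). e \<le> (\<Sum>a\<in>F. g a * snd p a) - c * snd p u}"
    by (rule closed_Collect_le[OF continuous_on_const continuous_on_diff[OF
          continuous_on_sum[OF continuous_on_mult[OF continuous_on_const cs]]
          continuous_on_mult[OF continuous_on_const cs]]])
  have "closed S" unfolding S_def by (rule closed_Int 1 2 3 4)+
  moreover have "compact R" unfolding R_def by (intro compact_Times compact_K compact_Pi_UNIV) simp
  ultimately have "compact (R \<inter> S)" by (simp add: compact_Int_closed)
  then have "compact (fst ` (R \<inter> S))"
    by (rule compact_continuous_image[rotated]) (rule continuous_on_fst[OF continuous_on_id])
  then have op: "open (- fst ` (R \<inter> S))" by (simp add: compact_imp_closed open_Compl)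
  have in_S: "y \<in> fst ` (R \<inter> S)"
    if y: "y \<in> K" and w: "meas w" "meas (\<lambda>a. y a - w a)" and ew: "e \<le> (\<Sum>a\<in>F. g a * w a) - c * w u" for y w
  proof -
    have le: "0 \<le> w a" "w a \<le> y a" for a
      using pea_measure_nonneg[OF w(1)] pea_measure_nonneg[OF w(2)] by simp_all
    then have "w a \<le> 1" for a using state_bounds[OF y, of a] by (meson order_trans)
    with le y have "(y, w) \<in> R" unfolding R_def by simp
    moreover have "(y, w) \<in> S"
      using le ew w(1) unfolding S_def pea_measure_def signed_measure_def by simp
    ultimately show ?thesis by (intro image_eqI[of _ _ "(y, w)"]) simp_all
  qed
  have "x \<notin> fst ` (R \<inter> S)"
  proof
    assume "x \<in> fst ` (R \<inter> S)"
    then obtain w where w: "(x, w) \<in> R" "(x, w) \<in> S" by auto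
    have xK: "x \<in> K" using extreme_subset x by blast
    have m: "meas w" using w(2) unfolding S_def pea_measure_def signed_measure_def by simp
    moreover have "meas (\<lambda>a. x a - w a)"
      using w(2) m xK unfolding S_def state_iff pea_measure_def signed_measure_def by simp
    ultimately have eq: "w a = w u * x a" for a by (rule meas_le_extreme[OF x])
    have "(\<Sum>a\<in>F. g a * w a) = (\<Sum>a\<in>F. w u * (g a * x a))"
      by (intro sum.cong refl) (subst eq, simp)
    also have "\<dots> = w u * (\<Sum>a\<in>F. g a * x a)" by (simp add: sum_distrib_left)
    also have "\<dots> \<le> w u * c" by (rule mult_left_mono[OF le pea_measure_nonneg[OF m]])
    finally have "(\<Sum>a\<in>F. g a * w a) - c * w u \<le> 0" by (simp add: mult.commute)
    moreover have "e \<le> (\<Sum>a\<in>F. g a * w a) - c * w u" using w(2) unfolding S_def by simp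
    ultimately show False using e by linarith
  qed
  show ?thesis
  proof (intro exI[of _ "- fst ` (R \<inter> S)"] conjI allI impI op)
    show "x \<in> - fst ` (R \<inter> S)" using \<open>x \<notin> fst ` (R \<inter> S)\<close> by simp
    fix y w
    assume y: "y \<in> - fst ` (R \<inter> S)" "y \<in> K" and w: "meas w" "meas (\<lambda>a. y a - w a)"
    have "\<not> e \<le> (\<Sum>a\<in>F. g a * w a) - c * w u"
      by (rule notI, rule notE[OF ComplD[OF y(1)]], rule in_S[OF y(2) w])
    then show "(\<Sum>a\<in>F. g a * w a) - c * w u < e" by (simp only: not_le)
  qed
qed

text \<open>A basic neighbourhood is cut out by finitely many coordinate intervals, so it contains the
  barycentre of every probability on a slightly smaller one.\<close>

lemma dominated_small_part:
  fixes g :: "'a \<Rightarrow> real"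
  assumes M: "prob_space M" "sets M = sets borel"
    and x: "x \<in> X" and le: "(\<Sum>a\<in>F. g a * x a) \<le> c" and e: "0 < e"
  shows "\<exists>W. open W \<and> x \<in> W \<and> (\<forall>B w. B \<in> sets borel \<longrightarrow> B \<subseteq> K \<longrightarrow> B \<subseteq> W \<longrightarrow> meas w \<longrightarrow>
     meas (\<lambda>a. moment M B a - w a) \<longrightarrow> (\<Sum>a\<in>F. g a * w a) - c * w u \<le> e * measure M B)"
proof -
  obtain V where V: "open V" "x \<in> V" and small: "\<forall>y w. y \<in> V \<longrightarrow> y \<in> K \<longrightarrow> meas w \<longrightarrow>
      meas (\<lambda>a. y a - w a) \<longrightarrow> (\<Sum>a\<in>F. g a * w a) - c * w u < e"
    using dominated_near_extreme[OF x le e] by (elim exE conjE)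
  obtain U where U: "finite {a. U a \<noteq> UNIV}" "\<forall>a. open (U a)" "\<forall>a. x a \<in> U a"
    "\<forall>y. (\<forall>a. y a \<in> U a) \<longrightarrow> y \<in> V"
    using open_fun_finite_coordinates[OF V] by (elim exE conjE)
  define I where "I = {a. U a \<noteq> UNIV}"
  have "\<exists>d>0. \<forall>r. \<bar>r - x a\<bar> \<le> d \<longrightarrow> r \<in> U a" for a
    by (rule real_open_cball[OF U(2)[rule_format] U(3)[rule_format]]) blast
  then obtain d where d: "\<And>a. 0 < d a" "\<And>a r. \<bar>r - x a\<bar> \<le> d a \<Longrightarrow> r \<in> U a" by metis
  \<comment> \<open>Strict inequalities keep \<open>W\<close> open. Averages over subsets of
    \<open>W\<close> satisfy the weak ones, and \<open>d\<close> was chosen so that these already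
    lead into \<open>U a\<close>.\<close>
  define W where "W = (\<Inter>a\<in>I. {y. \<bar>y a - x a\<bar> < d a})"
  have "open {y :: 'a \<Rightarrow> real. \<bar>y a - x a\<bar> < d a}" for a
    by (rule open_Collect_less[OF continuous_on_rabs[OF continuous_on_diff[OF continuous_on_coordinate
         continuous_on_const]] continuous_on_const])
  then have oW: "open W" unfolding W_def using U(1) I_def by (intro open_INT) simp_all
  show ?thesis
  proof (intro exI[of _ W] conjI allI impI oW)
    show "x \<in> W" unfolding W_def using d(1) by simp
    fix B w
    assume B: "B \<in> sets borel" "B \<subseteq> K" and BW: "B \<subseteq> W"
      and w: "meas w" "meas (\<lambda>a. moment M B a - w a)"
    define b where "b = measure M B"
    have pu: "moment M B u = b" unfolding b_def by (rule moment_unit[OF M B])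
    show "(\<Sum>a\<in>F. g a * w a) - c * w u \<le> e * measure M B"
    proof (cases "b = 0")
      case True
      have "w = (\<lambda>a. 0)"
        by (rule meas_null[OF w(1)]) (use pea_measure_nonneg[OF w(2), of u] pu True in simp)
      then show ?thesis using e by (simp add: measure_nonneg)
    next
      case False
      then have b: "0 < b" unfolding b_def by (simp add: zero_less_measure_iff)
      \<comment> \<open>Dividing by the mass turns the moment into a state near \<open>x\<close> and
        \<open>w\<close> into a measure below it; multiplying the resulting bound by
        \<open>b\<close> restores the factor \<open>measure M B\<close>.\<close>
      define p where "p a = moment M B a / b" for a
      have pK: "p \<in> K" unfolding p_def using normalize[OF moment_meas[OF M B]] pu b by simp
      have "p a \<in> U a" for a
      proof (cases "a \<in> I")
        case True
        have "x a - d a \<le> y a \<and> y a \<le> x a + d a" if "y \<in> B" for y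
        proof -
          have "\<bar>y a - x a\<bar> < d a" using that BW True unfolding W_def by blast
          then show ?thesis by linarith
        qed
        then have "(x a - d a) * b \<le> moment M B a" "moment M B a \<le> (x a + d a) * b"
          unfolding b_def using moment_lower[OF M B, of "x a - d a" a] moment_upper[OF M B, of a "x a + d a"] by simp_all
        then have "x a - d a \<le> p a" "p a \<le> x a + d a"
          unfolding p_def using b by (simp_all add: field_simps)
        then show ?thesis by (intro d(2)) linarith
      qed (simp add: I_def)
      then have pV: "p \<in> V" using U(4) by blast
      have "meas (\<lambda>a. (1 / b) * w a)" using w(1) b by (intro pea_measure_scale) simp_all
      moreover have "meas (\<lambda>a. p a - (1 / b) * w a)"
      proof -
        have "meas (\<lambda>a. (1 / b) * (moment M B a - w a))" using w(2) b by (intro pea_measure_scale) simp_all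
        moreover have "(\<lambda>a. (1 / b) * (moment M B a - w a)) = (\<lambda>a. p a - (1 / b) * w a)"
          by (rule ext) (simp add: p_def diff_divide_distrib)
        ultimately show ?thesis by simp
      qed
      ultimately have "(\<Sum>a\<in>F. g a * ((1 / b) * w a)) - c * ((1 / b) * w u) < e"
        by (rule small[rule_format, OF pV pK])
      moreover have "(\<Sum>a\<in>F. g a * ((1 / b) * w a)) = (\<Sum>a\<in>F. g a * w a) / b"
        by (simp add: sum_divide_distrib)
      ultimately have "((\<Sum>a\<in>F. g a * w a) - c * w u) / b < e" by (simp add: diff_divide_distrib)
      then show ?thesis using b unfolding b_def[symmetric] by (simp add: field_simps)
    qed
  qed
qed

text \<open>A finite cover of \<open>C\<close> by the neighbourhoods just found splits \<open>w\<close> by Riesz decomposition.\<close>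

lemma dominated_part:
  fixes g :: "'a \<Rightarrow> real"
  assumes ne: "K \<noteq> {}" and lattice: "lattice_cone (fcone K)"
    and M: "prob_space M" "sets M = sets borel"
    and C: "compact C" "C \<subseteq> X" and le: "\<And>x. x \<in> C \<Longrightarrow> (\<Sum>a\<in>F. g a * x a) \<le> c"
    and w: "meas w" "meas (\<lambda>a. moment M C a - w a)"
  shows "(\<Sum>a\<in>F. g a * w a) \<le> c * w u"
proof (rule field_le_epsilon)
  fix e :: real assume e: "0 < e"
  interpret prob_space M by fact
  have CK: "C \<subseteq> K" using C(2) extreme_subset by blast
  have "\<exists>W. open W \<and> x \<in> W \<and> (\<forall>B w. B \<in> sets borel \<longrightarrow> B \<subseteq> K \<longrightarrow> B \<subseteq> W \<longrightarrow> meas w \<longrightarrow>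
     meas (\<lambda>a. moment M B a - w a) \<longrightarrow> (\<Sum>a\<in>F. g a * w a) - c * w u \<le> e * measure M B)"
    if x: "x \<in> C" for x
    by (rule dominated_small_part[OF M subsetD[OF C(2) x] le[OF x] e])
  then have "\<forall>x\<in>C. \<exists>W. open W \<and> x \<in> W \<and> (\<forall>B w. B \<in> sets borel \<longrightarrow> B \<subseteq> K \<longrightarrow> B \<subseteq> W \<longrightarrow> meas w \<longrightarrow>
     meas (\<lambda>a. moment M B a - w a) \<longrightarrow> (\<Sum>a\<in>F. g a * w a) - c * w u \<le> e * measure M B)" by (rule ballI)
  from bchoice[OF this] obtain W where W: "\<forall>x\<in>C. open (W x) \<and> x \<in> W x \<and> (\<forall>B w. B \<in> sets borel \<longrightarrow>
     B \<subseteq> K \<longrightarrow> B \<subseteq> W x \<longrightarrow> meas w \<longrightarrow> meas (\<lambda>a. moment M B a - w a) \<longrightarrow>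
     (\<Sum>a\<in>F. g a * w a) - c * w u \<le> e * measure M B)"
    by (rule exE)
  note small = bspec[OF W, THEN conjunct2, THEN conjunct2, rule_format]
  obtain I where I: "I \<subseteq> C" "finite I" "C \<subseteq> (\<Union>x\<in>I. W x)"
    by (rule compactE_image[OF C(1), of C W]) (use W in auto)
  \<comment> \<open>Both \<open>B\<close> and \<open>w\<close> stay arbitrary because the induction
    step replaces them by \<open>B - W x\<close> and the Riesz remainder. The error is proportional
    to the mass, so over disjoint pieces it adds up to \<open>e * measure M B\<close>, whatever the
    size of the cover.\<close>
  have "(\<Sum>a\<in>F. g a * w a) - c * w u \<le> e * measure M B"
    if "B \<in> sets borel" "B \<subseteq> K" "B \<subseteq> (\<Union>x\<in>I. W x)" "meas w" "meas (\<lambda>a. moment M B a - w a)" for B w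
    using I(2,1) that
  proof (induction arbitrary: B w)
    case empty
    then have B: "B = {}" by simp
    have "w = (\<lambda>a. 0)"
      by (rule meas_null[OF empty.prems(5)])
         (use pea_measure_nonneg[OF empty.prems(6), of u] moment_unit[OF M empty.prems(2,3)] B in simp)
    then show ?case by (simp add: B)
  next
    case (insert x I)
    note B = insert.prems(2,3)
    let ?P = "B \<inter> W x" and ?Q = "B - W x"
    have x: "x \<in> C" using insert.prems(1) by simp
    have P: "?P \<in> sets borel" "?P \<subseteq> K" and Q: "?Q \<in> sets borel" "?Q \<subseteq> K"
      using B bspec[OF W x] by auto
    have BPQ: "?P \<union> ?Q = B" "?P \<inter> ?Q = {}" by auto
    have pB: "moment M B a = moment M ?P a + moment M ?Q a" for a
      using moment_Un[OF M P Q BPQ(2)] unfolding BPQ(1) .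
    obtain v where v: "meas v" "meas (\<lambda>a. w a - v a)" "meas (\<lambda>a. moment M ?P a - v a)"
      "meas (\<lambda>a. moment M ?Q a - (w a - v a))"
      by (rule Riesz_decomposition[OF ne lattice insert.prems(5) moment_meas[OF M P] moment_meas[OF M Q]])
         (use insert.prems(6) pB in simp_all)
    have "(\<Sum>a\<in>F. g a * v a) - c * v u \<le> e * measure M ?P"
      by (rule small[OF x P _ v(1,3)]) simp
    moreover have "(\<Sum>a\<in>F. g a * (w a - v a)) - c * (w u - v u) \<le> e * measure M ?Q"
      by (rule insert.IH[OF _ Q _ v(2,4)]) (use insert.prems(1,4) in auto)
    moreover have "measure M B = measure M ?P + measure M ?Q"
      using finite_measure_Union[of ?P ?Q] P(1) Q(1) BPQ M(2) by simp
    ultimately show ?case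
      by (simp add: algebra_simps sum_subtractf)
  qed
  from this[OF borel_compact[OF C(1)] CK I(3) w]
  have "(\<Sum>a\<in>F. g a * w a) - c * w u \<le> e * measure M C" .
  also have "\<dots> \<le> e * 1" using e by (intro mult_left_mono) simp_all
  finally show "(\<Sum>a\<in>F. g a * w a) \<le> c * w u + e" by simp
qed

end

section \<open>Existence and uniqueness of representing measures\<close>

context complemented
begin

text \<open>A functional with values at most \<open>c\<close> on \<open>barycentres C\<close>
  exceeds \<open>r > c\<close> on a neighbourhood \<open>V\<close> of \<open>x\<close>. The scaled
  moment of \<open>R\<close> over \<open>V \<inter> X\<close> lies below \<open>moment M C\<close>,
  so \<open>dominated_part\<close> bounds its functional by \<open>c\<close> times its mass, while
  integration gives at least \<open>r\<close> times that mass. So the mass is zero.\<close>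

lemma null_near_outside:
  assumes ne: "K \<noteq> {}" and lattice: "lattice_cone (fcone K)" and X: "compact X"
    and M: "prob_space M" "sets M = sets borel" and R: "prob_space R" "sets R = sets borel"
    and C: "compact C" "C \<subseteq> X" and t: "0 < t" and le: "meas (\<lambda>a. moment M C a - t * moment R X a)"
    and x: "x \<in> X" "x \<notin> C"
  shows "\<exists>V. open V \<and> x \<in> V \<and> emeasure R (V \<inter> X) = 0"
proof -
  interpret R: prob_space R by fact
  have CK: "C \<subseteq> K" using C(2) extreme_subset by blast
  obtain F g c where F: "\<And>y. y \<in> barycentres C \<Longrightarrow> (\<Sum>a\<in>F. g a * y a) \<le> c" "c < (\<Sum>a\<in>F. g a * x a)"
    using separation_compact_convex[OF compact_barycentres[OF C(1)] fconvex_barycentres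
      extreme_not_barycentre[OF C(1) CK x]] by metis
  define r where "r = (c + (\<Sum>a\<in>F. g a * x a)) / 2"
  have r: "c < r" "r < (\<Sum>a\<in>F. g a * x a)" using F(2) by (simp_all add: r_def)
  define V where "V = {p. r < (\<Sum>a\<in>F. g a * p a)}"
  have V: "open V" "x \<in> V"
    unfolding V_def using r(2)
    by (simp_all add: open_Collect_less[OF continuous_on_const continuous_on_linear])
  define B where "B = V \<inter> X"
  have B: "B \<in> sets borel" "B \<subseteq> K" "B \<subseteq> X"
    unfolding B_def using V(1) borel_compact[OF X] extreme_subset by auto
  define w where "w a = t * moment R B a" for a
  have w: "meas w" unfolding w_def using moment_meas[OF R B(1,2)] t by (intro pea_measure_scale) simp_all
  have "meas (\<lambda>a. t * (moment R X a - moment R B a))"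
    using moment_mono[OF R B(1) borel_compact[OF X] extreme_subset B(3)] t by (intro pea_measure_scale) simp_all
  then have "meas (\<lambda>a. t * moment R X a - w a)" by (simp add: w_def algebra_simps)
  from pea_measure_diff_trans[OF this le] have dom: "meas (\<lambda>a. moment M C a - w a)" .
  have "(\<Sum>a\<in>F. g a * w a) \<le> c * w u"
    by (rule dominated_part[OF ne lattice M C _ w dom])
       (use F(1) subset_barycentres[OF C(1) CK] in blast)
  moreover have "(\<Sum>a\<in>F. g a * w a) = t * (\<Sum>a\<in>F. g a * moment R B a)"
    by (simp add: w_def sum_distrib_left algebra_simps)
  moreover have "(\<Sum>a\<in>F. - g a * moment R B a) \<le> - r * measure R B"
    by (rule moment_linear[OF R B(1,2)]) (simp add: B_def V_def sum_negf)
  moreover have "w u = t * measure R B" by (simp add: w_def moment_unit[OF R B(1,2)])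
  ultimately have "t * (\<Sum>a\<in>F. g a * moment R B a) \<le> t * (c * measure R B)"
     "r * measure R B \<le> (\<Sum>a\<in>F. g a * moment R B a)"
    by (simp_all add: sum_negf algebra_simps)
  then have "(r - c) * measure R B \<le> 0" using t by (simp add: algebra_simps)
  then have "measure R B = 0" using r(1) by (simp add: mult_le_0_iff measure_le_0_iff)
  then show ?thesis using V unfolding B_def by (auto simp: R.emeasure_eq_measure)
qed

text \<open>Every point of \<open>X\<close> lies outside \<open>C\<close> or outside
  \<open>D\<close>, so the measure \<open>R\<close> representing the normalized \<open>w\<close> is
  locally null on the compact \<open>X\<close>, against its mass 1.\<close>

lemma disjoint_parts_meet:
  assumes ne: "K \<noteq> {}" and lattice: "lattice_cone (fcone K)" and X: "compact X"
    and M: "prob_space M" "sets M = sets borel" and N: "prob_space N" "sets N = sets borel"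
    and C: "compact C" "C \<subseteq> X" and D: "compact D" "D \<subseteq> X" and CD: "C \<inter> D = {}"
    and w: "meas w" "meas (\<lambda>a. moment M C a - w a)" "meas (\<lambda>a. moment N D a - w a)"
  shows "w u = 0"
proof (rule ccontr)
  assume "w u \<noteq> 0"
  then have wu: "0 < w u" using pea_measure_nonneg[OF w(1), of u] by simp
  have "(\<lambda>a. w a / w u) \<in> barycentres X"
    using normalize[OF w(1) wu] barycentres_extreme[OF ne X] by simp
  then obtain R where R: "prob_space R" "sets R = sets borel" "measure R X = 1"
    and eq: "(\<lambda>a. w a / w u) = moment R X"
    by (rule barycentre_representation[OF X extreme_subset])
  interpret R: prob_space R by fact
  define t where "t = w u"
  have t: "0 < t" using wu by (simp add: t_def)
  have "w = (\<lambda>a. t * moment R X a)"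
  proof (rule ext)
    show "w a = t * moment R X a" for a
      using fun_cong[OF eq, of a] wu by (simp add: t_def field_simps)
  qed
  from w(2,3)[unfolded this]
  have C': "meas (\<lambda>a. moment M C a - t * moment R X a)" and D': "meas (\<lambda>a. moment N D a - t * moment R X a)" .
  have "emeasure R X = 0"
  proof (rule cover_null[OF R(2) X])
    fix x assume x: "x \<in> X"
    show "\<exists>V. open V \<and> x \<in> V \<and> emeasure R (V \<inter> X) = 0"
    proof (cases "x \<in> C")
      case False
      show ?thesis by (rule null_near_outside[OF ne lattice X M R(1,2) C t C' x False])
    next
      case True
      then have "x \<notin> D" using CD by blast
      show ?thesis by (rule null_near_outside[OF ne lattice X N R(1,2) D t D' x \<open>x \<notin> D\<close>])
    qed
  qed
  then show False using R(3) by (simp add: R.emeasure_eq_measure)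
qed

text \<open>Cutting \<open>X\<close> into \<open>C = X - U\<close> and \<open>U \<inter> X\<close>
  splits the common barycentre. Riesz decomposition of \<open>moment N D\<close> has no component
  below \<open>moment M C\<close>, because \<open>C\<close> and \<open>D\<close> are disjoint, so
  \<open>moment N D\<close> lies below the other part; evaluation at \<open>u\<close> compares the
  masses.\<close>

lemma measure_le_of_same_barycentre:
  assumes ne: "K \<noteq> {}" and lattice: "lattice_cone (fcone K)" and X: "compact X"
    and M: "prob_space M" "sets M = sets borel" and N: "prob_space N" "sets N = sets borel"
    and eq: "moment M X = moment N X"
    and D: "compact D" "D \<subseteq> X" and U: "open U" "D \<subseteq> U"
  shows "measure N D \<le> measure M (U \<inter> X)"
proof -
  have Xb: "X \<in> sets borel" by (rule borel_compact[OF X])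
  have Db: "D \<in> sets borel" by (rule borel_compact[OF D(1)])
  have DK: "D \<subseteq> K" using D(2) extreme_subset by blast
  define C where "C = X - U"
  have C: "compact C" "C \<subseteq> X" "C \<inter> D = {}" unfolding C_def using X U by (auto intro: compact_diff)
  have CK: "C \<in> sets borel" "C \<subseteq> K" using C(2) extreme_subset borel_compact[OF C(1)] by blast+
  let ?Q = "U \<inter> X"
  have Q: "?Q \<in> sets borel" "?Q \<subseteq> K" using U(1) Xb extreme_subset by auto
  have split: "moment M X a = moment M C a + moment M ?Q a" for a
  proof -
    have "C \<union> ?Q = X" "C \<inter> ?Q = {}" unfolding C_def by auto
    then show ?thesis using moment_Un[OF M CK Q, of a] by simp
  qed
  have "meas (\<lambda>a. moment N X a - moment N D a)" by (rule moment_mono[OF N Db Xb extreme_subset D(2)])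
  then have "meas (\<lambda>a. moment M C a + moment M ?Q a - moment N D a)" by (simp add: eq[symmetric] split)
  then obtain v where v: "meas v" "meas (\<lambda>a. moment N D a - v a)" "meas (\<lambda>a. moment M C a - v a)"
    "meas (\<lambda>a. moment M ?Q a - (moment N D a - v a))"
    by (rule Riesz_decomposition[OF ne lattice moment_meas[OF N Db DK] moment_meas[OF M CK] moment_meas[OF M Q]])
  have "v u = 0"
    by (rule disjoint_parts_meet[OF ne lattice X M N C(1,2) D C(3) v(1,3,2)])
  with pea_measure_nonneg[OF v(4), of u] show ?thesis
    by (simp add: moment_unit[OF N Db DK] moment_unit[OF M Q])
qed

text \<open>Representing measures live on the Borel sets of \<open>K\<close>. Pushing them forward
  along the inclusion makes them Borel measures on the full function space, where the results on
  moments apply.\<close>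

lemma borel_on_states:
  assumes r: "representing_measure pl u s \<mu>" and X: "compact X"
  defines "M \<equiv> distr \<mu> borel (\<lambda>x. x)"
  shows "prob_space M" "sets M = sets borel" "\<And>A. A \<in> sets borel \<Longrightarrow> measure M A = measure \<mu> (A \<inter> K)"
    "moment M X = s" "measure M X = 1"
proof -
  have mu: "prob_space \<mu>" "sets \<mu> = sets (restrict_space borel K)" "space \<mu> = K"
    using r unfolding representing_measure_def regular_borel_prob_def by simp_all
  interpret prob_space \<mu> by fact
  have id: "(\<lambda>x. x) \<in> measurable \<mu> borel"
    unfolding measurable_cong_sets[OF mu(2) refl]
    by (rule measurable_restrict_space1) (rule measurable_ident_sets[OF refl])
  show "prob_space M" unfolding M_def by (rule prob_space_distr[OF id])
  show "sets M = sets borel" unfolding M_def by simp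
  show mM: "measure M A = measure \<mu> (A \<inter> K)" if "A \<in> sets borel" for A
    unfolding M_def using measure_distr[OF id that] mu(3) by simp
  have Xb: "X \<in> sets borel" by (rule borel_compact[OF X])
  show "moment M X = s"
  proof (rule ext)
    fix a
    have "(\<lambda>x. indicator X x *\<^sub>R x a) \<in> borel_measurable borel"
      using Xb by (rule borel_measurable_scaleR[OF borel_measurable_indicator borel_measurable_coordinate])
    then have "moment M X a = (LINT x:X|\<mu>. x a)"
      unfolding moment_def M_def set_lebesgue_integral_def by (rule integral_distr[OF id])
    then show "moment M X a = s a" using r unfolding representing_measure_def by simp
  qed
  show "measure M X = 1"
    using mM[OF Xb] r extreme_subset unfolding representing_measure_def by (simp add: Int_absorb2)
qed

text \<open>Outer regularity of \<open>\<mu>\<close> reduces the claim to relatively open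
  neighbourhoods of \<open>D\<close>, where the common barycentre decides.\<close>

lemma representing_measure_le_compact:
  assumes ne: "K \<noteq> {}" and lattice: "lattice_cone (fcone K)" and X: "compact X"
    and m: "representing_measure pl u s \<mu>" and n: "representing_measure pl u s \<nu>"
    and D: "compact D" "D \<subseteq> K"
  shows "measure \<nu> D \<le> measure \<mu> D"
proof -
  define M where "M = distr \<mu> borel (\<lambda>x. x)"
  define N where "N = distr \<nu> borel (\<lambda>x. x)"
  note M = borel_on_states[OF m X, folded M_def]
  note N = borel_on_states[OF n X, folded N_def]
  interpret M: prob_space M by (rule M(1))
  interpret N: prob_space N by (rule N(1))
  have Xb: "X \<in> sets borel" by (rule borel_compact[OF X])
  have Db: "D \<in> sets borel" by (rule borel_compact[OF D(1)])
  \<comment> \<open>All mass sits on \<open>X\<close>, so \<open>D\<close> may be replaced by its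
    compact trace on \<open>X\<close>.\<close>
  have DX: "measure N D = measure N (D \<inter> X)"
  proof -
    have "measure N (D - X) \<le> measure N (space N - X)"
      using Db Xb N(2) sets_eq_imp_space_eq[OF N(2)] by (intro N.finite_measure_mono) auto
    also have "\<dots> = 0" using N.prob_compl[of X] N(5) Xb N(2) by simp
    finally have "measure N (D - X) = 0" by (simp add: measure_le_0_iff)
    moreover have "measure N ((D \<inter> X) \<union> (D - X)) = measure N (D \<inter> X) + measure N (D - X)"
      using Db Xb N(2) by (intro N.finite_measure_Union) auto
    moreover have "(D \<inter> X) \<union> (D - X) = D" by blast
    ultimately show ?thesis by simp
  qed
  have reg: "\<forall>A\<in>sets \<mu>. measure \<mu> A = (INF U\<in>{U. openin (top_of_set K) U \<and> A \<subseteq> U}. measure \<mu> U)"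
    and sets: "sets \<mu> = sets (restrict_space borel K)"
    using m unfolding representing_measure_def regular_borel_prob_def by blast+
  have "D \<in> sets \<mu>" unfolding sets using Db D(2) by (auto simp: sets_restrict_space)
  then have "measure \<mu> D = (INF U\<in>{U. openin (top_of_set K) U \<and> D \<subseteq> U}. measure \<mu> U)" using reg by blast
  moreover have "measure \<nu> D \<le> (INF U\<in>{U. openin (top_of_set K) U \<and> D \<subseteq> U}. measure \<mu> U)"
  proof (rule cINF_greatest)
    have "openin (top_of_set K) K" by simp
    then show "{U. openin (top_of_set K) U \<and> D \<subseteq> U} \<noteq> {}" using D(2) by blast
    fix U assume "U \<in> {U. openin (top_of_set K) U \<and> D \<subseteq> U}"
    then obtain T where T: "open T" "U = K \<inter> T" and DU: "D \<subseteq> U" by (auto simp: openin_open)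
    have "measure \<nu> D = measure N (D \<inter> X)" using N(3)[OF Db] D(2) DX by (simp add: Int_absorb2)
    also have "\<dots> \<le> measure M (T \<inter> X)"
      using D(1) X T DU M(4) N(4)
      by (intro measure_le_of_same_barycentre[OF ne lattice X M(1,2) N(1,2)])
         (auto intro: compact_Int)
    also have "\<dots> \<le> measure M T"
      using T(1) Xb M(2) by (intro M.finite_measure_mono) auto
    also have "\<dots> = measure \<mu> U" using M(3)[of T] T by (simp add: Int_commute)
    finally show "measure \<nu> D \<le> measure \<mu> U" .
  qed
  ultimately show ?thesis by simp
qed

text \<open>Inner regularity extends the comparison from compact sets to all Borel sets.\<close>

lemma representing_measure_unique:
  assumes ne: "K \<noteq> {}" and lattice: "lattice_cone (fcone K)" and X: "compact X"
    and m: "representing_measure pl u s \<mu>" and n: "representing_measure pl u s \<nu>"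
  shows "\<nu> = \<mu>"
proof -
  \<comment> \<open>Generalized over the two measures, so that exchanging them gives the reverse
    inequality.\<close>
  have le: "measure \<nu> A \<le> measure \<mu> A"
    if m: "representing_measure pl u s \<mu>" and n: "representing_measure pl u s \<nu>" and A: "A \<in> sets \<nu>" for \<mu> \<nu> A
  proof -
    have mu: "prob_space \<mu>" "sets \<mu> = sets (restrict_space borel K)"
      and nu: "sets \<nu> = sets (restrict_space borel K)"
      and reg: "\<forall>A\<in>sets \<nu>. measure \<nu> A = (SUP C\<in>{C. compact C \<and> C \<subseteq> A}. measure \<nu> C)"
      using m n unfolding representing_measure_def regular_borel_prob_def by blast+
    interpret prob_space \<mu> by fact
    have AK: "A \<subseteq> K" using A unfolding nu by (auto simp: sets_restrict_space)
    have "measure \<nu> A = (SUP C\<in>{C. compact C \<and> C \<subseteq> A}. measure \<nu> C)" using reg A by blast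
    also have "\<dots> \<le> measure \<mu> A"
    proof (rule cSUP_least)
      have "compact ({} :: ('a \<Rightarrow> real) set)" by simp
      then show "{C. compact C \<and> C \<subseteq> A} \<noteq> {}" by blast
      fix C assume "C \<in> {C. compact C \<and> C \<subseteq> A}"
      then have C: "compact C" "C \<subseteq> A" by auto
      have "measure \<nu> C \<le> measure \<mu> C"
        using C AK by (intro representing_measure_le_compact[OF ne lattice X m n]) auto
      also have "\<dots> \<le> measure \<mu> A" using C(2) A nu mu(2) by (intro finite_measure_mono) simp_all
      finally show "measure \<nu> C \<le> measure \<mu> A" .
    qed
    finally show ?thesis .
  qed
  have mu: "prob_space \<mu>" "sets \<mu> = sets (restrict_space borel K)"
    and nu: "prob_space \<nu>" "sets \<nu> = sets (restrict_space borel K)"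
    using m n unfolding representing_measure_def regular_borel_prob_def by simp_all
  interpret m: prob_space \<mu> by (rule mu(1))
  interpret n: prob_space \<nu> by (rule nu(1))
  show ?thesis
  proof (rule measure_eqI)
    show "sets \<nu> = sets \<mu>" using mu nu by simp
    fix A assume A: "A \<in> sets \<nu>"
    then have "measure \<nu> A = measure \<mu> A" using le[OF m n] le[OF n m] mu(2) nu(2) by (intro antisym) simp_all
    then show "emeasure \<nu> A = emeasure \<mu> A" by (simp add: m.emeasure_eq_measure n.emeasure_eq_measure)
  qed
qed

section \<open>Existence of a regular representing measure\<close>

lemma representing_measure_exists:
  assumes X: "compact X" and s: "s \<in> K"
  shows "\<exists>\<mu>. representing_measure pl u s \<mu>"
proof -
  have Xb: "X \<in> sets borel" by (rule borel_compact[OF X])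
  have Kb: "K \<in> sets borel" by (rule borel_compact[OF compact_K])
  have "s \<in> barycentres X" using barycentres_extreme[OF _ X] s by blast
  then show ?thesis
  proof (rule barycentre_representation[OF X extreme_subset])
    fix M :: "('a \<Rightarrow> real) measure"
    assume M: "prob_space M" "sets M = sets borel" "measure M X = 1" "s = moment M X"
      and outer: "\<And>A e. A \<in> sets borel \<Longrightarrow> 0 < e \<Longrightarrow> \<exists>U. open U \<and> A \<subseteq> U \<and> measure M U < measure M A + e"
      and inner: "\<And>A e. A \<in> sets borel \<Longrightarrow> 0 < e \<Longrightarrow> \<exists>D. compact D \<and> D \<subseteq> A \<inter> X \<and> measure M A < measure M D + e"
    interpret prob_space M by fact
    have sp: "space M = UNIV" using sets_eq_imp_space_eq[OF M(2)] by simp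
    have KM: "K \<inter> space M \<in> sets M" using Kb M(2) sp by simp
    \<comment> \<open>Restriction to \<open>K\<close> keeps the values on subsets of
      \<open>K\<close> and the regularity: compact approximants already lie in
      \<open>A \<inter> X\<close>, and open ones are intersected with \<open>K\<close>.\<close>
    define \<mu> where "\<mu> = restrict_space M K"
    have sets: "sets \<mu> = sets (restrict_space borel K)"
      unfolding \<mu>_def by (rule sets_restrict_space_cong[OF M(2)])
    have space: "space \<mu> = K" unfolding \<mu>_def by (simp add: space_restrict_space sp)
    have meas: "measure \<mu> A = measure M A" if "A \<subseteq> K" for A
      unfolding \<mu>_def by (rule measure_restrict_space[OF KM that])
    have "measure M X \<le> measure M K" using Kb M(2) extreme_subset by (intro finite_measure_mono) simp_all
    then have MK: "measure M K = 1" using M(3) prob_le_1[of K] by simp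
    have prob: "prob_space \<mu>"
    proof (rule prob_spaceI)
      have "emeasure \<mu> K = emeasure M K"
        unfolding \<mu>_def by (rule emeasure_restrict_space[OF KM subset_refl])
      then show "emeasure \<mu> (space \<mu>) = 1" by (simp add: space emeasure_eq_measure MK)
    qed
    have setsD: "A \<in> sets borel" "A \<subseteq> K" if "A \<in> sets \<mu>" for A
      using that Kb unfolding sets by (auto simp: sets_restrict_space)
    have "measure \<mu> A = (SUP C\<in>{C. compact C \<and> C \<subseteq> A}. measure \<mu> C)" (is "_ = Sup (_ ` ?S)")
      if A: "A \<in> sets \<mu>" for A
    proof (rule antisym)
      have le: "measure \<mu> C \<le> measure \<mu> A" if "C \<in> ?S" for C
      proof -
        have "C \<subseteq> A" "C \<subseteq> K" using that setsD[OF A] by auto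
        then show ?thesis
          using setsD[OF A] M(2) by (simp add: meas finite_measure_mono)
      qed
      have "compact ({} :: ('a \<Rightarrow> real) set)" by simp
      then have "?S \<noteq> {}" by blast
      then show "(SUP C\<in>?S. measure \<mu> C) \<le> measure \<mu> A" by (rule cSUP_least) (rule le)
      have bdd: "bdd_above (measure \<mu> ` ?S)" by (rule bdd_aboveI2[OF le])
      show "measure \<mu> A \<le> (SUP C\<in>?S. measure \<mu> C)"
      proof (rule field_le_epsilon)
        fix e :: real assume "0 < e"
        from inner[OF setsD(1)[OF A] this] obtain D where D: "compact D" "D \<subseteq> A \<inter> X"
          "measure M A < measure M D + e" by (elim exE conjE)
        have "measure \<mu> D \<le> (SUP C\<in>?S. measure \<mu> C)" using D by (intro cSUP_upper bdd) auto
        moreover have "measure \<mu> D = measure M D" using D(2) setsD(2)[OF A] by (intro meas) auto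
        ultimately show "measure \<mu> A \<le> (SUP C\<in>?S. measure \<mu> C) + e"
          using D(3) meas[OF setsD(2)[OF A]] by simp
      qed
    qed
    moreover have "measure \<mu> A = (INF U\<in>{U. openin (top_of_set K) U \<and> A \<subseteq> U}. measure \<mu> U)" (is "_ = Inf (_ ` ?S)")
      if A: "A \<in> sets \<mu>" for A
    proof (rule antisym)
      have le: "measure \<mu> A \<le> measure \<mu> U" if U: "U \<in> ?S" for U
      proof -
        obtain T where T: "open T" "U = K \<inter> T" using U by (auto simp: openin_open)
        have "U \<subseteq> K" "U \<in> sets M" using T Kb M(2) by auto
        then show ?thesis
          using U setsD(2)[OF A] by (simp add: meas finite_measure_mono)
      qed
      have "K \<in> ?S" using setsD(2)[OF A] by simp
      then have "?S \<noteq> {}" by blast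
      then show "measure \<mu> A \<le> (INF U\<in>?S. measure \<mu> U)" by (rule cINF_greatest) (rule le)
      have bdd: "bdd_below (measure \<mu> ` ?S)" by (rule bdd_belowI2[OF le])
      show "(INF U\<in>?S. measure \<mu> U) \<le> measure \<mu> A"
      proof (rule field_le_epsilon)
        fix e :: real assume "0 < e"
        from outer[OF setsD(1)[OF A] this] obtain T where T: "open T" "A \<subseteq> T"
          "measure M T < measure M A + e" by (elim exE conjE)
        have "K \<inter> T \<in> ?S" using T setsD(2)[OF A] by auto
        then have "(INF U\<in>?S. measure \<mu> U) \<le> measure \<mu> (K \<inter> T)" by (rule cINF_lower[OF bdd])
        moreover have "measure \<mu> (K \<inter> T) = measure M (K \<inter> T)" by (rule meas) simp
        moreover have "measure M (K \<inter> T) \<le> measure M T" using T(1) M(2) by (intro finite_measure_mono) auto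
        ultimately show "(INF U\<in>?S. measure \<mu> U) \<le> measure \<mu> A + e"
          using T(3) meas[OF setsD(2)[OF A]] by simp
      qed
    qed
    ultimately have "regular_borel_prob K \<mu>"
      unfolding regular_borel_prob_def using sets space prob by simp
    moreover have "measure \<mu> X = 1" using meas[OF extreme_subset] M(3) by simp
    moreover have "s a = (LINT x:X|\<mu>. x a)" for a
    proof -
      have "(LINT x:X|\<mu>. x a) = (LINT x|M. indicator K x *\<^sub>R (indicator X x *\<^sub>R x a))"
        unfolding \<mu>_def set_lebesgue_integral_def by (rule integral_restrict_space[OF KM])
      also have "\<dots> = (LINT x|M. indicator X x *\<^sub>R x a)"
      proof (rule Bochner_Integration.integral_cong[OF refl])
        fix x show "indicator K x *\<^sub>R (indicator X x *\<^sub>R x a) = indicator X x *\<^sub>R x a"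
          using extreme_subset by (cases "x \<in> X") auto
      qed
      finally show ?thesis using fun_cong[OF M(4), of a] unfolding moment_def set_lebesgue_integral_def by simp
    qed
    ultimately have "representing_measure pl u s \<mu>" unfolding representing_measure_def by simp
    then show ?thesis by (rule exI)
  qed
qed

end

theorem theorem5p8:
  fixes pl :: "'a \<Rightarrow> 'a \<Rightarrow> 'a option" and z u :: 'a
    and m s1 s2 :: "'a \<Rightarrow> real" and \<alpha>1 \<alpha>2 :: real
  assumes "pseudo_effect_algebra pl z u"
    and "state_space pl u \<noteq> {}"
    and "bauer_simplex (state_space pl u)"
    and "jordan_signed_measure pl m"
    and "canonical_jordan_decomposition pl u m \<alpha>1 s1 \<alpha>2 s2"
  shows "\<exists>\<mu>1 \<mu>2.
     representing_measure pl u s1 \<mu>1 \<and> (\<forall>\<nu>. representing_measure pl u s1 \<nu> \<longrightarrow> \<nu> = \<mu>1) \<and>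
     representing_measure pl u s2 \<mu>2 \<and> (\<forall>\<nu>. representing_measure pl u s2 \<nu> \<longrightarrow> \<nu> = \<mu>2) \<and>
     (\<forall>a. m a = \<alpha>1 * (LINT x:fextreme_points (state_space pl u)|\<mu>1. x a)
                - \<alpha>2 * (LINT x:fextreme_points (state_space pl u)|\<mu>2. x a))"
proof -
  \<comment> \<open>Complements are the existence half of axiom (ii).\<close>
  interpret complemented pl u
    by unfold_locales (use assms(1) in \<open>unfold pseudo_effect_algebra_def, blast\<close>)
  have X: "compact X" and lattice: "lattice_cone (fcone K)"
    using assms(3) unfolding bauer_simplex_def fsimplex_def by simp_all
  have s: "s1 \<in> K" "s2 \<in> K" and dec: "m = (\<lambda>a. \<alpha>1 * s1 a - \<alpha>2 * s2 a)"
    using assms(5) unfolding canonical_jordan_decomposition_def state_space_def by simp_all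
  obtain \<mu>1 where m1: "representing_measure pl u s1 \<mu>1"
    using representing_measure_exists[OF X s(1)] by (rule exE)
  obtain \<mu>2 where m2: "representing_measure pl u s2 \<mu>2"
    using representing_measure_exists[OF X s(2)] by (rule exE)
  note unique = representing_measure_unique[OF assms(2) lattice X]
  have "m a = \<alpha>1 * (LINT x:X|\<mu>1. x a) - \<alpha>2 * (LINT x:X|\<mu>2. x a)" for a
  proof -
    have "s1 a = (LINT x:X|\<mu>1. x a)" "s2 a = (LINT x:X|\<mu>2. x a)"
      using m1 m2 unfolding representing_measure_def by simp_all
    then show ?thesis using fun_cong[OF dec, of a] by simp
  qed
  with m1 m2 show ?thesis by (intro exI[of _ \<mu>1] exI[of _ \<mu>2] conjI allI impI unique)
qed

end
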